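(* Let $d\in\mathbb N$ and $\alpha\in[1/2,1)$. Then there exist $n$ and $k$ in $\mathbb N$ depending only on $d,\alpha$ such that the following holds. Let $T$ be a complete first-order theory with monster model $\mathcal U$. If $\phi(x,y)$ is a formula such that $\mathrm{vc}(\phi)\leq d$, then for any (small) $A\subseteq\mathcal U^x$ and any (small) partial type $\pi(y)$, any $p\in S^\pi_{\phi^{\mathrm{opp}}}(A)$ is the $\alpha$-rounded average of $n$ types in $S^\pi_{\phi^{\mathrm{opp}}\downarrow k}(A)$. Namely, we may take $n:=\min\{m\in\mathbb N:(1-\alpha)m>2^{d+1}-1\}$ and $k:=k_{\mathrm{sd}}(N_{\mathrm{pq}}(n,2^{d+1}),d)$.
   Context: $\mathcal U$ is a large saturated model of $T$; small means of cardinality $<|\mathcal U|$; $\vdash$ is implication in $\mathcal U$. $\mathrm{vc}(\phi)$ is the VC-dimension of the family $\{\phi(\mathcal U^x,b):b\in\mathcal U^y\}$ of subsets of $\mathcal U^x$. A partial type is a consistent set of formulas. $\phi^1=\phi$, $\phi^0=\neg\phi$. $\phi^{\mathrm{opp}}$ is $\phi$ with the roles of $x,y$ exchanged: for $A\subseteq\mathcal U^x$, a $\phi^{\mathrm{opp}}$-type over $A$ is a maximal consistent set of formulas $\phi(a,y)$, $\neg\phi(a,y)$ with $a\in A$. $S^\pi_{\phi^{\mathrm{opp}}}(A)$ is the set of such types consistent with $\pi(y)$. For such $p$ and $A_0\subseteq A$, $p|_{A_0}$ is the set of formulas in $p$ with parameter in $A_0$. $p$ is $k$-compressible modulo $\pi$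 if for every finite $A_0\subseteq A$ there is $A_1\subseteq A$, $|A_1|\leq k$, with $p|_{A_1}\cup\pi\vdash p|_{A_0}$; $S^\pi_{\phi^{\mathrm{opp}}\downarrow k}(A)$ is the set of those $p\in S^\pi_{\phi^{\mathrm{opp}}}(A)$ which are $k$-compressible modulo $\pi$. The $\alpha$-rounded average of $\phi^{\mathrm{opp}}$-types $p_0,\dots,p_{n-1}$ over $A$ is the set of formulas $\{\phi(a,y)^\epsilon: a\in A,\ \epsilon<2,\ |\{i<n:\phi(a,y)^\epsilon\in p_i\}|>\alpha n\}$. Functions: $k_{\mathrm{comp}}(d)=2^{d+1}(d-2)+d+4$; $\binom{s}{\leq k}=\sum_{i\leq k}\binom si$; $B_{\mathrm{vc}}(n,k)=\max\{s\in\mathbb N:\binom{s}{\leq k}^n\geq 2^s\}$; $k_{\mathrm{sd}}(1,d)=k_{\mathrm{comp}}(d)+2d+2$ and $k_{\mathrm{sd}}(n,d)=n\cdot k_{\mathrm{sd}}(1,2^{B_{\mathrm{vc}}(n,2^{d+1})+1})$ for $n\neq1$. $N_{\mathrm{pq}}:\mathbb N^2\to\mathbb N$ is a fixed function as provided by the (known) $(p,q)$-theorem of Alon–Kleitman and Matoušek: for all $q\leq p<\omega$, if $(X,\mathcal F)$ is a finite set system ($\mathcal F\subseteq\mathcal P(X)$) of non-empty sets whose dual family $\{\{s\in\mathcal F:x\in s\}:x\in X\}$ has VC-dimension $<q$, and such that every $S\subseteq\mathcal F$ with $|S|\geq p$ contains $S_0\subseteq S$ with $|S_0|\geq q$ and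 $\bigcap S_0\neq\emptyset$, then there is $X_0\subseteq X$ with $|X_0|\leq N_{\mathrm{pq}}(p,q)$ meeting every $s\in\mathcal F$. *)

theory Defs
  imports Complex_Main "HOL-Library.FuncSet" "HOL-Library.Extended_Nat"
begin

unbundle cardinal_syntax

section \<open>First-order logic\<close>

text \<open>A language is given by its sets of function symbols (constants being the nullary ones) and
  of relation symbols, each symbol coming with its arity.\<close>

record ('f, 'r) language =
  funcs :: "('f \<times> nat) set"
  rels :: "('r \<times> nat) set"

datatype 'f tm = Var nat | Fn 'f "'f tm list"

datatype ('f, 'r) fm =
    Eq "'f tm" "'f tm"
  | Rel 'r "'f tm list"
  | Neg "('f, 'r) fm"
  | Conj "('f, 'r) fm" "('f, 'r) fm"
  | Exists nat "('f, 'r) fm"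

fun wf_tm :: "('f, 'r) language \<Rightarrow> 'f tm \<Rightarrow> bool" where
  "wf_tm L (Var v) \<longleftrightarrow> True"
| "wf_tm L (Fn f ts) \<longleftrightarrow> (f, length ts) \<in> funcs L \<and> (\<forall>t\<in>set ts. wf_tm L t)"

fun wf_fm :: "('f, 'r) language \<Rightarrow> ('f, 'r) fm \<Rightarrow> bool" where
  "wf_fm L (Eq s t) \<longleftrightarrow> wf_tm L s \<and> wf_tm L t"
| "wf_fm L (Rel R ts) \<longleftrightarrow> (R, length ts) \<in> rels L \<and> (\<forall>t\<in>set ts. wf_tm L t)"
| "wf_fm L (Neg \<phi>) \<longleftrightarrow> wf_fm L \<phi>"
| "wf_fm L (Conj \<phi> \<psi>) \<longleftrightarrow> wf_fm L \<phi> \<and> wf_fm L \<psi>"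
| "wf_fm L (Exists v \<phi>) \<longleftrightarrow> wf_fm L \<phi>"

fun fv_tm :: "'f tm \<Rightarrow> nat set" where
  "fv_tm (Var v) = {v}"
| "fv_tm (Fn f ts) = (\<Union>t\<in>set ts. fv_tm t)"

fun fv :: "('f, 'r) fm \<Rightarrow> nat set" where
  "fv (Eq s t) = fv_tm s \<union> fv_tm t"
| "fv (Rel R ts) = (\<Union>t\<in>set ts. fv_tm t)"
| "fv (Neg \<phi>) = fv \<phi>"
| "fv (Conj \<phi> \<psi>) = fv \<phi> \<union> fv \<psi>"
| "fv (Exists v \<phi>) = fv \<phi> - {v}"

definition formulas :: "('f, 'r) language \<Rightarrow> nat set \<Rightarrow> ('f, 'r) fm set" where
  "formulas L V = {\<phi>. wf_fm L \<phi> \<and> fv \<phi> \<subseteq> V}"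

abbreviation sentences :: "('f, 'r) language \<Rightarrow> ('f, 'r) fm set" where
  "sentences L \<equiv> formulas L {}"

record ('f, 'r, 'u) fo_structure =
  univ :: "'u set"
  func :: "'f \<Rightarrow> 'u list \<Rightarrow> 'u"
  rel :: "'r \<Rightarrow> 'u list \<Rightarrow> bool"

definition is_structure :: "('f, 'r) language \<Rightarrow> ('f, 'r, 'u) fo_structure \<Rightarrow> bool" where
  "is_structure L M \<longleftrightarrow> univ M \<noteq> {} \<and>
     (\<forall>(f, n)\<in>funcs L. \<forall>us. length us = n \<and> set us \<subseteq> univ M \<longrightarrow> func M f us \<in> univ M)"

fun eval :: "('f, 'r, 'u) fo_structure \<Rightarrow> (nat \<Rightarrow> 'u) \<Rightarrow> 'f tm \<Rightarrow> 'u" where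
  "eval M e (Var v) = e v"
| "eval M e (Fn f ts) = func M f (map (eval M e) ts)"

fun sat :: "('f, 'r, 'u) fo_structure \<Rightarrow> (nat \<Rightarrow> 'u) \<Rightarrow> ('f, 'r) fm \<Rightarrow> bool" where
  "sat M e (Eq s t) \<longleftrightarrow> eval M e s = eval M e t"
| "sat M e (Rel R ts) \<longleftrightarrow> rel M R (map (eval M e) ts)"
| "sat M e (Neg \<phi>) \<longleftrightarrow> \<not> sat M e \<phi>"
| "sat M e (Conj \<phi> \<psi>) \<longleftrightarrow> sat M e \<phi> \<and> sat M e \<psi>"
| "sat M e (Exists v \<phi>) \<longleftrightarrow> (\<exists>u\<in>univ M. sat M (e(v := u)) \<phi>)"

definition is_model ::
    "('f, 'r) language \<Rightarrow> ('f, 'r, 'u) fo_structure \<Rightarrow> ('f, 'r) fm set \<Rightarrow> bool" where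
  "is_model L M T \<longleftrightarrow> is_structure L M \<and> (\<forall>\<sigma>\<in>T. \<forall>e. sat M e \<sigma>)"

text \<open>In the next two definitions the universe of the model \<open>N\<close> is a subset of the type of
  formulas.  By the downward Loewenheim-Skolem theorem this is no restriction: this type has at
  least as many elements as there are \<open>L\<close>-formulas, so every model of \<open>T\<close> is elementarily
  equivalent to one of this kind.\<close>

definition entails :: "('f, 'r) language \<Rightarrow> ('f, 'r) fm set \<Rightarrow> ('f, 'r) fm \<Rightarrow> bool" where
  "entails L T \<sigma> \<longleftrightarrow>
     (\<forall>N :: ('f, 'r, ('f, 'r) fm) fo_structure. is_model L N T \<longrightarrow> (\<forall>e. sat N e \<sigma>))"

definition complete_theory :: "('f, 'r) language \<Rightarrow> ('f, 'r) fm set \<Rightarrow> bool" where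
  "complete_theory L T \<longleftrightarrow> T \<subseteq> sentences L \<and>
     (\<exists>N :: ('f, 'r, ('f, 'r) fm) fo_structure. is_model L N T) \<and>
     (\<forall>\<sigma>\<in>sentences L. entails L T \<sigma> \<or> entails L T (Neg \<sigma>))"

section \<open>Parameters, partial types and the monster model\<close>

text \<open>Parameters are new constants: \<open>Inr u\<close> names the element \<open>u\<close>.\<close>

definition lang_params :: "('f, 'r) language \<Rightarrow> 'u set \<Rightarrow> ('f + 'u, 'r) language" where
  "lang_params L A =
     \<lparr>funcs = {(Inl f, n) |f n. (f, n) \<in> funcs L} \<union> {(Inr a, 0) |a. a \<in> A}, rels = rels L\<rparr>"

definition with_params :: "('f, 'r, 'u) fo_structure \<Rightarrow> ('f + 'u, 'r, 'u) fo_structure" where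
  "with_params M = \<lparr>univ = univ M, func = case_sum (func M) (\<lambda>u _. u), rel = rel M\<rparr>"

text \<open>A tuple of variables is a finite set \<open>x\<close> of variables, and the elements of \<open>tuples M x\<close> are the
  assignments of elements of \<open>M\<close> to these variables.\<close>

definition tuples :: "('f, 'r, 'u) fo_structure \<Rightarrow> nat set \<Rightarrow> (nat \<Rightarrow> 'u) set" where
  "tuples M x = (x \<rightarrow>\<^sub>E univ M)"

definition realizes ::
    "('f, 'r, 'u) fo_structure \<Rightarrow> (nat \<Rightarrow> 'u) \<Rightarrow> ('f + 'u, 'r) fm set \<Rightarrow> bool" where
  "realizes M b \<Sigma> \<longleftrightarrow> (\<forall>\<psi>\<in>\<Sigma>. sat (with_params M) b \<psi>)"

definition implies ::
    "('f, 'r, 'u) fo_structure \<Rightarrow> nat set \<Rightarrow> ('f + 'u, 'r) fm set \<Rightarrow> ('f + 'u, 'r) fm set \<Rightarrow> bool"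
  where
  "implies M y \<Sigma> \<Theta> \<longleftrightarrow> (\<forall>b\<in>tuples M y. realizes M b \<Sigma> \<longrightarrow> realizes M b \<Theta>)"

text \<open>Consistency, with the elementary diagram of \<open>M\<close>, is finite satisfiability in \<open>M\<close>.\<close>

definition consistent ::
    "('f, 'r, 'u) fo_structure \<Rightarrow> nat set \<Rightarrow> ('f + 'u, 'r) fm set \<Rightarrow> bool" where
  "consistent M y \<Sigma> \<longleftrightarrow> (\<forall>\<Sigma>0\<subseteq>\<Sigma>. finite \<Sigma>0 \<longrightarrow> (\<exists>b\<in>tuples M y. realizes M b \<Sigma>0))"

definition partial_type ::
    "('f, 'r) language \<Rightarrow> ('f, 'r, 'u) fo_structure \<Rightarrow> 'u set \<Rightarrow> nat set
      \<Rightarrow> ('f + 'u, 'r) fm set \<Rightarrow> bool" where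
  "partial_type L M A y \<pi> \<longleftrightarrow> \<pi> \<subseteq> formulas (lang_params L A) y \<and> consistent M y \<pi>"

definition small :: "('f, 'r, 'u) fo_structure \<Rightarrow> 'a set \<Rightarrow> bool" where
  "small M A \<longleftrightarrow> |A| <o |univ M|"

definition saturated :: "('f, 'r) language \<Rightarrow> ('f, 'r, 'u) fo_structure \<Rightarrow> bool" where
  "saturated L M \<longleftrightarrow>
     (\<forall>A\<subseteq>univ M. small M A \<longrightarrow>
       (\<forall>y. finite y \<longrightarrow> (\<forall>\<Sigma>. partial_type L M A y \<Sigma> \<longrightarrow> (\<exists>b\<in>tuples M y. realizes M b \<Sigma>))))"

text \<open>An infinite monster model has more elements than there are formulas.  A finite one cannot be
  required to: it is then the only model of its theory up to isomorphism.\<close>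

definition monster_model ::
    "('f, 'r) language \<Rightarrow> ('f, 'r) fm set \<Rightarrow> ('f, 'r, 'u) fo_structure \<Rightarrow> bool" where
  "monster_model L T M \<longleftrightarrow> is_model L M T \<and> saturated L M \<and>
     (infinite (univ M) \<longrightarrow> small M (formulas L UNIV))"

section \<open>VC-dimension\<close>

definition shatters :: "'a set set \<Rightarrow> 'a set \<Rightarrow> bool" where
  "shatters \<F> B \<longleftrightarrow> (\<forall>C\<subseteq>B. \<exists>S\<in>\<F>. S \<inter> B = C)"

definition vc_dim :: "'a set set \<Rightarrow> enat" where
  "vc_dim \<F> = Sup {enat (card B) |B. finite B \<and> shatters \<F> B}"

definition vc :: "('f, 'r, 'u) fo_structure \<Rightarrow> nat set \<Rightarrow> nat set \<Rightarrow> ('f, 'r) fm \<Rightarrow> enat" where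
  "vc M x y \<phi> =
     vc_dim ((\<lambda>b. {a \<in> tuples M x. sat M (override_on b a x) \<phi>}) ` tuples M y)"

section \<open>Types in the opposite formula\<close>

fun inst_tm :: "nat set \<Rightarrow> (nat \<Rightarrow> 'u) \<Rightarrow> 'f tm \<Rightarrow> ('f + 'u) tm" where
  "inst_tm x a (Var v) = (if v \<in> x then Fn (Inr (a v)) [] else Var v)"
| "inst_tm x a (Fn f ts) = Fn (Inl f) (map (inst_tm x a) ts)"

text \<open>\<open>inst x a \<phi>\<close> is the formula \<open>\<phi>(a,y)\<close>: the free occurrences of the variables in \<open>x\<close> are
  replaced by the parameters \<open>a\<close>.\<close>

fun inst :: "nat set \<Rightarrow> (nat \<Rightarrow> 'u) \<Rightarrow> ('f, 'r) fm \<Rightarrow> ('f + 'u, 'r) fm" where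
  "inst x a (Eq s t) = Eq (inst_tm x a s) (inst_tm x a t)"
| "inst x a (Rel R ts) = Rel R (map (inst_tm x a) ts)"
| "inst x a (Neg \<phi>) = Neg (inst x a \<phi>)"
| "inst x a (Conj \<phi> \<psi>) = Conj (inst x a \<phi>) (inst x a \<psi>)"
| "inst x a (Exists v \<phi>) = Exists v (inst (x - {v}) a \<phi>)"

definition fm_pow :: "('f, 'r) fm \<Rightarrow> bool \<Rightarrow> ('f, 'r) fm" where
  "fm_pow \<phi> \<epsilon> = (if \<epsilon> then \<phi> else Neg \<phi>)"

definition opp_fms ::
    "nat set \<Rightarrow> ('f, 'r) fm \<Rightarrow> (nat \<Rightarrow> 'u) set \<Rightarrow> ('f + 'u, 'r) fm set" where
  "opp_fms x \<phi> A = {fm_pow (inst x a \<phi>) \<epsilon> |a \<epsilon>. a \<in> A}"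

definition opp_type ::
    "('f, 'r, 'u) fo_structure \<Rightarrow> nat set \<Rightarrow> nat set \<Rightarrow> ('f, 'r) fm \<Rightarrow> (nat \<Rightarrow> 'u) set
      \<Rightarrow> ('f + 'u, 'r) fm set \<Rightarrow> bool" where
  "opp_type M x y \<phi> A p \<longleftrightarrow> p \<subseteq> opp_fms x \<phi> A \<and> consistent M y p \<and>
     (\<forall>p'. p \<subseteq> p' \<and> p' \<subseteq> opp_fms x \<phi> A \<and> consistent M y p' \<longrightarrow> p' = p)"

definition opp_types ::
    "('f, 'r, 'u) fo_structure \<Rightarrow> nat set \<Rightarrow> nat set \<Rightarrow> ('f, 'r) fm \<Rightarrow> ('f + 'u, 'r) fm set
      \<Rightarrow> (nat \<Rightarrow> 'u) set \<Rightarrow> ('f + 'u, 'r) fm set set" where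
  "opp_types M x y \<phi> \<pi> A = {p. opp_type M x y \<phi> A p \<and> consistent M y (p \<union> \<pi>)}"

definition type_restrict ::
    "nat set \<Rightarrow> ('f, 'r) fm \<Rightarrow> ('f + 'u, 'r) fm set \<Rightarrow> (nat \<Rightarrow> 'u) set
      \<Rightarrow> ('f + 'u, 'r) fm set" where
  "type_restrict x \<phi> p A0 = p \<inter> opp_fms x \<phi> A0"

definition compressible ::
    "('f, 'r, 'u) fo_structure \<Rightarrow> nat set \<Rightarrow> nat set \<Rightarrow> ('f, 'r) fm \<Rightarrow> ('f + 'u, 'r) fm set
      \<Rightarrow> (nat \<Rightarrow> 'u) set \<Rightarrow> nat \<Rightarrow> ('f + 'u, 'r) fm set \<Rightarrow> bool" where
  "compressible M x y \<phi> \<pi> A k p \<longleftrightarrow>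
     (\<forall>A0\<subseteq>A. finite A0 \<longrightarrow>
       (\<exists>A1\<subseteq>A. finite A1 \<and> card A1 \<le> k \<and>
          implies M y (type_restrict x \<phi> p A1 \<union> \<pi>) (type_restrict x \<phi> p A0)))"

definition compressible_opp_types ::
    "('f, 'r, 'u) fo_structure \<Rightarrow> nat set \<Rightarrow> nat set \<Rightarrow> ('f, 'r) fm \<Rightarrow> ('f + 'u, 'r) fm set
      \<Rightarrow> nat \<Rightarrow> (nat \<Rightarrow> 'u) set \<Rightarrow> ('f + 'u, 'r) fm set set" where
  "compressible_opp_types M x y \<phi> \<pi> k A =
     {p \<in> opp_types M x y \<phi> \<pi> A. compressible M x y \<phi> \<pi> A k p}"

definition rounded_average ::
    "nat set \<Rightarrow> ('f, 'r) fm \<Rightarrow> (nat \<Rightarrow> 'u) set \<Rightarrow> real \<Rightarrow> nat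
      \<Rightarrow> (nat \<Rightarrow> ('f + 'u, 'r) fm set) \<Rightarrow> ('f + 'u, 'r) fm set" where
  "rounded_average x \<phi> A \<alpha> n P =
     {fm_pow (inst x a \<phi>) \<epsilon> |a \<epsilon>.
        a \<in> A \<and> real (card {i. i < n \<and> fm_pow (inst x a \<phi>) \<epsilon> \<in> P i}) > \<alpha> * real n}"

section \<open>The bounds\<close>

text \<open>The integer under \<open>nat\<close> is nonnegative for every \<open>d\<close> (it is 0, 1 and 6 for \<open>d\<close> = 0, 1, 2).\<close>

definition k_comp :: "nat \<Rightarrow> nat" where
  "k_comp d = nat (2 ^ (d + 1) * (int d - 2) + int d + 4)"

definition binom_le :: "nat \<Rightarrow> nat \<Rightarrow> nat" where
  "binom_le s k = (\<Sum>i\<le>k. s choose i)"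

definition B_vc :: "nat \<Rightarrow> nat \<Rightarrow> nat" where
  "B_vc n k = Max {s. binom_le s k ^ n \<ge> 2 ^ s}"

definition k_sd :: "nat \<Rightarrow> nat \<Rightarrow> nat" where
  "k_sd n d =
     (let k1 = (\<lambda>e. k_comp e + 2 * e + 2)
      in if n = 1 then k1 d else n * k1 (2 ^ (B_vc n (2 ^ (d + 1)) + 1)))"

text \<open>\<open>N\<close> is a function as provided by the \<open>(p,q)\<close>-theorem.  Only finite set systems are involved,
  so that it suffices to consider those on sets of natural numbers.\<close>

definition pq_function :: "(nat \<Rightarrow> nat \<Rightarrow> nat) \<Rightarrow> bool" where
  "pq_function N \<longleftrightarrow>
     (\<forall>p q. q \<le> p \<longrightarrow>
       (\<forall>(X :: nat set) \<F>.
          finite X \<and> \<F> \<subseteq> Pow X \<and> {} \<notin> \<F> \<and>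
          vc_dim ((\<lambda>u. {s \<in> \<F>. u \<in> s}) ` X) < enat q \<and>
          (\<forall>\<S>\<subseteq>\<F>. card \<S> \<ge> p \<longrightarrow> (\<exists>\<S>0\<subseteq>\<S>. card \<S>0 \<ge> q \<and> X \<inter> \<Inter>\<S>0 \<noteq> {})) \<longrightarrow>
          (\<exists>X0\<subseteq>X. card X0 \<le> N p q \<and> (\<forall>s\<in>\<F>. X0 \<inter> s \<noteq> {}))))"

end

theory Submission
  imports Defs "HOL-Library.Sublist"
begin

text \<open>Types over \<open>A\<close> are identified with the sets of points of \<open>A\<close> at which they disagree with
  \<open>p\<close>; they form a closed class \<open>C\<close> of VC-dimension at most \<open>d\<close>, and \<open>p\<close> becomes the empty set.
  If no \<open>n\<close> compressible members of \<open>C\<close> are such that every point lies in fewer than \<open>2 ^ (d + 1)\<close>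
  of them, then the \<open>(p,q)\<close>-theorem and compactness yield boundedly many ultrafilters on \<open>A\<close>
  such that every compressible member is large for one of them.  This contradicts a strong form of
  the density of compressible types: some compressible member is small for all of these
  ultrafilters.

  Density is obtained by iterating a Zorn's lemma version of the Chen--Cheng--Tang
  bound on the recursive teaching dimension: restricting \<open>C\<close> to a maximal compressible partial
  type lowers the VC-dimension.  Strong density follows by applying density to the class of those
  members of \<open>C\<close> that extend a finite, maximally alternating generic pattern and
  still admit generic zeros after it.\<close>

section \<open>Ultrafilters\<close>

text \<open>Plain density gives no control over a compressible member along prescribed ultrafilters,
  so it does not refute a transversal made of ultrafilters; the class has to be cut down to members
  that stay generically zero. This requirement is not expressed by literals. The main obstacle is to
  turn compressibility inside the smaller class into compressibility inside \<open>C\<close>: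
  counterexamples that do not admit the remaining generic zeros are excluded by concrete points, at
  most one for each letter of the word.

  The choice of constants is not circular, because the number \<open>N\<close> of ultrafilters
  depends only on \<alpha>, \<open>d\<close> and the given (p,q)-function, and a member avoiding
  \<open>N\<close> ultrafilters is found with compressibility
  \<open>K_dens d + 2 * (N * d) + (N * d + 1) * N\<close>. This is at most \<open>k_sd N d\<close>
  once \<open>2 \<le> N\<close>, so one \<open>k\<close> both defines the family to be pierced and
  bounds the member that escapes. The number \<open>2 ^ (d + 1)\<close> is the dual VC-bound: it is
  the \<open>q\<close> of the (p,q)-theorem, and hence the number of members through a point that
  the average has to avoid.\<close>

definition ultra :: "'a filter \<Rightarrow> bool" where
  "ultra U \<longleftrightarrow> U \<noteq> bot \<and> (\<forall>P. eventually P U \<or> eventually (\<lambda>x. \<not> P x) U)"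

lemma ultra_not_eventually: "ultra U \<Longrightarrow> \<not> eventually P U \<longleftrightarrow> eventually (\<lambda>x. \<not> P x) U"
  unfolding ultra_def using eventually_conj[of P U "\<lambda>x. \<not> P x"] by (auto simp: trivial_limit_def)

lemma ultra_disj: "ultra U \<Longrightarrow> eventually (\<lambda>x. P x \<or> Q x) U \<longleftrightarrow> eventually P U \<or> eventually Q U"
  using ultra_not_eventually[of U "\<lambda>x. P x \<or> Q x"] ultra_not_eventually[of U P]
    ultra_not_eventually[of U Q] by (auto simp: eventually_conj_iff)

lemma ultra_Bex_finite:
  assumes "ultra U" "finite I" "eventually (\<lambda>x. \<exists>i\<in>I. P i x) U"
  shows "\<exists>i\<in>I. eventually (P i) U"
proof (rule ccontr)
  assume "\<not> ?thesis"
  hence "\<forall>i\<in>I. eventually (\<lambda>x. \<not> P i x) U" using assms(1) by (simp add: ultra_not_eventually)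
  hence "eventually (\<lambda>x. \<forall>i\<in>I. \<not> P i x) U" using assms(2) by (simp add: eventually_ball_finite)
  thus False using assms(1,3) ultra_not_eventually[OF assms(1), of "\<lambda>x. \<exists>i\<in>I. P i x"] by simp
qed

lemma ultra_filtermap: "ultra U \<Longrightarrow> ultra (filtermap f U)"
  by (simp add: ultra_def eventually_filtermap filtermap_bot_iff)

lemma ultra_happens: "ultra U \<Longrightarrow> eventually P U \<Longrightarrow> \<exists>x. P x"
  by (metis ultra_def eventually_happens)

text \<open>Zorn's lemma downwards: the infimum of a nonempty chain of proper filters is proper
  because every event in it already occurs in one member. A minimal proper filter decides
  \<open>P\<close>, as its restriction to \<open>P\<close> is either improper or the filter
  itself.\<close>

lemma ultra_exists:
  assumes "F \<noteq> bot"
  shows "\<exists>U. ultra U \<and> U \<le> F"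
proof -
  let ?A = "{G. G \<noteq> bot \<and> G \<le> F}"
  have "\<exists>m\<in>?A. \<forall>a\<in>?A. m \<ge> a \<longrightarrow> a = m"
  proof (rule predicate_Zorn)
    show "partial_order_on ?A (relation_of (\<ge>) ?A)"
      by (rule partial_order_on_relation_ofI) auto
    fix K assume K: "K \<in> Chains (relation_of (\<ge>) ?A)"
    hence KA: "K \<subseteq> ?A" and tot: "\<And>G H. G \<in> K \<Longrightarrow> H \<in> K \<Longrightarrow> G \<le> H \<or> H \<le> G"
      by (auto simp: Chains_def relation_of_def)
    show "\<exists>u\<in>?A. \<forall>a\<in>K. a \<ge> u"
    proof (cases "K = {}")
      case True then show ?thesis using assms by auto
    next
      case False
      have "eventually P (Inf K) \<longleftrightarrow> (\<exists>b\<in>K. eventually P b)" for P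
        by (rule eventually_Inf_base[OF False]) (metis inf.absorb1 inf.absorb2 order_refl tot)
      hence "Inf K \<noteq> bot" using KA by (auto simp: trivial_limit_def)
      moreover have "Inf K \<le> F" using False KA by (auto intro: Inf_lower2)
      ultimately show ?thesis by (auto intro: Inf_lower)
    qed
  qed
  then obtain U where U: "U \<noteq> bot" "U \<le> F" and max: "\<And>G. G \<noteq> bot \<Longrightarrow> G \<le> U \<Longrightarrow> G = U"
    by fastforce
  have "eventually P U \<or> eventually (\<lambda>x. \<not> P x) U" for P
  proof (cases "inf U (principal {x. P x}) = bot")
    case True
    then show ?thesis
      by (auto simp: trivial_limit_def eventually_inf_principal)
  next
    case False
    from max[OF this] have "U \<le> principal {x. P x}" by (metis inf.cobounded1 inf.cobounded2)
    then show ?thesis by (simp add: le_principal)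
  qed
  with U show ?thesis by (auto simp: ultra_def)
qed

lemma ultra_fip:
  assumes "\<And>X. finite X \<Longrightarrow> X \<subseteq> I \<Longrightarrow> (\<Inter>i\<in>X. H i) \<noteq> {}"
  shows "\<exists>U. ultra U \<and> (\<forall>i\<in>I. eventually (\<lambda>x. x \<in> H i) U)"
proof -
  let ?F = "INF i\<in>I. principal (H i)"
  have "?F \<noteq> bot"
  proof (rule INF_filter_not_bot)
    fix X assume "X \<subseteq> I" "finite X"
    thus "(INF i\<in>X. principal (H i)) \<noteq> bot"
      using assms by (simp add: INF_principal_finite principal_eq_bot_iff)
  qed
  then obtain U where U: "ultra U" "U \<le> ?F" using ultra_exists by blast
  have "eventually (\<lambda>x. x \<in> H i) U" if "i \<in> I" for i
  proof (rule filter_leD)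
    show "U \<le> principal (H i)" using U(2) INF_lower[OF that, of "\<lambda>i. principal (H i)"] by (rule order_trans)
  qed (simp add: eventually_principal)
  thus ?thesis using U(1) by blast
qed

section \<open>Closed classes of sets\<close>

text \<open>\<open>G\<close> is a partial type made of literals: \<open>(a, e)\<close> prescribes
  the truth value \<open>e\<close> at the point \<open>a\<close>.\<close>

definition mods :: "'a set set \<Rightarrow> ('a \<times> bool) set \<Rightarrow> 'a set set" where
  "mods C G = {c \<in> C. \<forall>(a, e)\<in>G. (a \<in> c) = e}"

text \<open>Closedness in the product topology, whose basic neighbourhoods fix finitely many
  memberships.\<close>

definition closed_class :: "'a set set \<Rightarrow> bool" where
  "closed_class C \<longleftrightarrow> (\<forall>c. (\<forall>B. finite B \<longrightarrow> (\<exists>c'\<in>C. c' \<inter> B = c \<inter> B)) \<longrightarrow> c \<in> C)"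

text \<open>\<open>C\<close> plays the part of \<pi>: its members are the competitors to be
  distinguished from \<open>c\<close>.\<close>

definition compr :: "'a set set \<Rightarrow> nat \<Rightarrow> 'a set \<Rightarrow> bool" where
  "compr C k c \<longleftrightarrow> (\<forall>A0. finite A0 \<longrightarrow> (\<exists>A1. finite A1 \<and> card A1 \<le> k \<and>
     (\<forall>c'\<in>C. c' \<inter> A1 = c \<inter> A1 \<longrightarrow> c' \<inter> A0 = c \<inter> A0)))"

lemma compr_mono: "compr C k c \<Longrightarrow> k \<le> k' \<Longrightarrow> compr C k' c"
  unfolding compr_def by (meson order_trans)

definition ulim :: "'a set filter \<Rightarrow> 'a set" where
  "ulim U = {a. eventually (\<lambda>c. a \<in> c) U}"

lemma eventually_ulim:
  assumes "ultra U" "finite B"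
  shows "eventually (\<lambda>c. c \<inter> B = ulim U \<inter> B) U"
proof -
  have "eventually (\<lambda>c. (a \<in> c) = (a \<in> ulim U)) U" for a
    using assms(1) by (cases "a \<in> ulim U") (auto simp: ulim_def ultra_not_eventually[symmetric])
  hence "eventually (\<lambda>c. \<forall>a\<in>B. (a \<in> c) = (a \<in> ulim U)) U"
    using assms(2) by (simp add: eventually_ball_finite)
  thus ?thesis by (rule eventually_mono) auto
qed

lemma closed_ulim:
  assumes "closed_class C" "ultra U" "eventually (\<lambda>c. c \<in> C) U"
  shows "ulim U \<in> C"
proof -
  have "\<exists>c'\<in>C. c' \<inter> B = ulim U \<inter> B" if "finite B" for B
    using ultra_happens[OF assms(2) eventually_conj[OF assms(3) eventually_ulim[OF assms(2) that]]]
    by blast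
  thus ?thesis using assms(1) by (auto simp: closed_class_def)
qed

lemma mods_Un: "mods C (G \<union> H) = mods (mods C G) H"
  by (auto simp: mods_def)

lemma mods_insert: "mods C (insert (a, e) G) = mods {c \<in> C. (a \<in> c) = e} G"
  by (auto simp: mods_def)

lemma mods_antimono: "G \<subseteq> H \<Longrightarrow> mods C H \<subseteq> mods C G"
  by (auto simp: mods_def)

lemma mods_subset: "mods C G \<subseteq> C"
  by (auto simp: mods_def)

lemma closed_mods:
  assumes "closed_class C"
  shows "closed_class (mods C G)"
  unfolding closed_class_def
proof (intro allI impI)
  fix c assume *: "\<forall>B. finite B \<longrightarrow> (\<exists>c'\<in>mods C G. c' \<inter> B = c \<inter> B)"
  hence "c \<in> C" using assms unfolding closed_class_def by (meson mods_subset subsetD)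
  moreover have "(a \<in> c) = e" if "(a, e) \<in> G" for a e
    using *[rule_format, of "{a}"] that by (auto simp: mods_def)
  ultimately show "c \<in> mods C G" by (auto simp: mods_def)
qed

lemma closed_finite_condition:
  assumes "closed_class C" "finite B"
    and "\<And>c c'. c \<inter> B = c' \<inter> B \<Longrightarrow> P c \<Longrightarrow> P c'"
  shows "closed_class {c \<in> C. P c}"
  unfolding closed_class_def
proof (intro allI impI)
  fix c assume *: "\<forall>B. finite B \<longrightarrow> (\<exists>c'\<in>{c \<in> C. P c}. c' \<inter> B = c \<inter> B)"
  hence "c \<in> C" using assms(1) unfolding closed_class_def by (metis (mono_tags) mem_Collect_eq)
  moreover obtain c' where "c' \<in> {c \<in> C. P c}" "c' \<inter> B = c \<inter> B" using * assms(2) by blast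
  hence "P c" using assms(3)[of c' c] by simp
  ultimately show "c \<in> {c \<in> C. P c}" by simp
qed

text \<open>The classes \<open>mods C G0\<close> for finite \<open>G0\<close> have the finite
  intersection property. The limit of an ultrafilter containing all of them satisfies every literal,
  since a literal is a finite condition.\<close>

lemma mods_compact:
  assumes "closed_class C" and fin: "\<And>G0. finite G0 \<Longrightarrow> G0 \<subseteq> G \<Longrightarrow> mods C G0 \<noteq> {}"
  shows "mods C G \<noteq> {}"
proof -
  let ?I = "{G0. finite G0 \<and> G0 \<subseteq> G}"
  have "(\<Inter>G0\<in>X. mods C G0) \<noteq> {}" if "finite X" "X \<subseteq> ?I" for X
  proof -
    have "mods C (\<Union>X) \<noteq> {}" by (rule fin) (use that in auto)
    moreover have "mods C (\<Union>X) \<subseteq> (\<Inter>G0\<in>X. mods C G0)"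
      by (rule INT_greatest) (rule mods_antimono, blast)
    ultimately show ?thesis by blast
  qed
  then obtain U where U: "ultra U" and ev: "\<And>G0. G0 \<in> ?I \<Longrightarrow> eventually (\<lambda>c. c \<in> mods C G0) U"
    using ultra_fip[of ?I "mods C"] by blast
  have evm: "eventually (\<lambda>c. c \<in> mods C G0) U" if "finite G0" "G0 \<subseteq> G" for G0
    using ev that by simp
  have "ulim U \<in> C" using closed_ulim[OF assms(1) U] evm[of "{}"] by (simp add: mods_def)
  moreover have "(a \<in> ulim U) = e" if "(a, e) \<in> G" for a e
  proof -
    have "ulim U \<in> mods C {(a, e)}"
      by (rule closed_ulim[OF closed_mods[OF assms(1)] U]) (use evm[of "{(a,e)}"] that in auto)
    thus ?thesis by (simp add: mods_def)
  qed
  ultimately have "ulim U \<in> mods C G" by (auto simp: mods_def)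
  thus ?thesis by blast
qed

section \<open>Shattering and bounds on the VC-dimension\<close>

lemma shatters_subset: "shatters C B \<Longrightarrow> B' \<subseteq> B \<Longrightarrow> shatters C B'"
  unfolding shatters_def
proof (intro allI impI)
  fix D assume "\<forall>D\<subseteq>B. \<exists>S\<in>C. S \<inter> B = D" "B' \<subseteq> B" "D \<subseteq> B'"
  then obtain S where "S \<in> C" "S \<inter> B = D" by (meson order_trans)
  thus "\<exists>S\<in>C. S \<inter> B' = D" using \<open>B' \<subseteq> B\<close> \<open>D \<subseteq> B'\<close> by (intro bexI[of _ S]) auto
qed

lemma shatters_mono: "shatters C B \<Longrightarrow> C \<subseteq> C' \<Longrightarrow> shatters C' B"
  unfolding shatters_def by (meson subsetD)

definition vc_le :: "'a set set \<Rightarrow> nat \<Rightarrow> bool" where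
  "vc_le C d \<longleftrightarrow> (\<forall>B. finite B \<longrightarrow> shatters C B \<longrightarrow> card B \<le> d)"

lemma vc_le_mono: "vc_le C d \<Longrightarrow> C' \<subseteq> C \<Longrightarrow> vc_le C' d"
  unfolding vc_le_def by (meson shatters_mono)

lemma vc_leI_card:
  assumes "\<And>B. finite B \<Longrightarrow> card B = Suc d \<Longrightarrow> \<not> shatters C B"
  shows "vc_le C d"
  unfolding vc_le_def
proof (intro allI impI)
  fix B assume "finite B" "shatters C B"
  show "card B \<le> d"
  proof (rule ccontr)
    assume "\<not> ?thesis"
    then obtain B' where "B' \<subseteq> B" "card B' = Suc d" using obtain_subset_with_card_n[of "Suc d" B]
      by (metis not_less_eq_eq)
    moreover have "finite B'" "shatters C B'"
      using \<open>B' \<subseteq> B\<close> \<open>finite B\<close> \<open>shatters C B\<close> finite_subset shatters_subset by auto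
    ultimately show False using assms by blast
  qed
qed

section \<open>Density of compressible elements\<close>

text \<open>Each drop of the dimension from \<open>Suc d\<close> to \<open>d\<close> costs a partial
  type of compressibility \<open>2 ^ Suc d * Suc d\<close>, the size that the exchange argument
  keeps stable.\<close>

fun K_dens :: "nat \<Rightarrow> nat" where
  "K_dens 0 = 0"
| "K_dens (Suc d) = K_dens d + 2 ^ Suc d * Suc d"

text \<open>The version of \<open>compr\<close> for partial, possibly infinite types. Only literals
  of the type itself may be used, so the property passes to unions of chains.\<close>

definition compr_lits :: "'a set set \<Rightarrow> nat \<Rightarrow> ('a \<times> bool) set set" where
  "compr_lits C k = {G. mods C G \<noteq> {} \<and> (\<forall>G0. finite G0 \<longrightarrow> G0 \<subseteq> G \<longrightarrow>
     (\<exists>G1\<subseteq>G. finite G1 \<and> card G1 \<le> k \<and> mods C G1 \<subseteq> mods C G0))}"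

lemma compr_lits_maximal:
  assumes "closed_class C" "C \<noteq> {}"
  shows "\<exists>G\<in>compr_lits C k. \<forall>H\<in>compr_lits C k. G \<subseteq> H \<longrightarrow> H = G"
proof (rule subset_Zorn_nonempty)
  have "mods C {} = C" by (simp add: mods_def)
  hence "{} \<in> compr_lits C k" using assms(2) by (auto simp: compr_lits_def)
  thus "compr_lits C k \<noteq> {}" by blast
next
  fix \<C> assume ne: "\<C> \<noteq> {}" and ch: "subset.chain (compr_lits C k) \<C>"
  have sub: "\<C> \<subseteq> compr_lits C k" using ch by (auto simp: subset.chain_def)
  have cover: "\<exists>G\<in>\<C>. G0 \<subseteq> G" if "finite G0" "G0 \<subseteq> \<Union>\<C>" for G0
    using finite_subset_Union_chain[OF that ne ch] by metis
  show "\<Union>\<C> \<in> compr_lits C k"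
    unfolding compr_lits_def
  proof (intro CollectI conjI allI impI)
    show "mods C (\<Union>\<C>) \<noteq> {}"
    proof (rule mods_compact[OF assms(1)])
      fix G0 assume "finite G0" "G0 \<subseteq> \<Union>\<C>"
      then obtain G where "G \<in> \<C>" "G0 \<subseteq> G" using cover by blast
      thus "mods C G0 \<noteq> {}" using sub mods_antimono[of G0 G C] by (auto simp: compr_lits_def)
    qed
    fix G0 assume "finite G0" "G0 \<subseteq> \<Union>\<C>"
    then obtain G where G: "G \<in> \<C>" "G0 \<subseteq> G" using cover by blast
    hence "\<exists>G1\<subseteq>G. finite G1 \<and> card G1 \<le> k \<and> mods C G1 \<subseteq> mods C G0"
      using sub \<open>finite G0\<close> by (auto simp: compr_lits_def)
    thus "\<exists>G1\<subseteq>\<Union>\<C>. finite G1 \<and> card G1 \<le> k \<and> mods C G1 \<subseteq> mods C G0"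
      using G(1) by blast
  qed
qed

text \<open>The \<open>l\<close> points force the values on \<open>A0\<close> only modulo all of
  \<open>G\<close>. By compactness a finite part of \<open>G\<close> suffices, and that part follows
  from \<open>k\<close> literals of \<open>G\<close>.\<close>

lemma compr_trans:
  assumes C: "closed_class C" and G: "G \<in> compr_lits C k"
    and q: "q \<in> mods C G" and cq: "compr (mods C G) l q"
  shows "compr C (l + k) q"
  unfolding compr_def
proof (intro allI impI)
  fix A0 :: "'a set" assume A0: "finite A0"
  obtain A1 where A1: "finite A1" "card A1 \<le> l"
    and imp: "\<And>c. c \<in> mods C G \<Longrightarrow> c \<inter> A1 = q \<inter> A1 \<Longrightarrow> c \<inter> A0 = q \<inter> A0"
    using cq A0 unfolding compr_def by metis
  let ?P = "\<lambda>c. c \<inter> A1 = q \<inter> A1 \<and> c \<inter> A0 \<noteq> q \<inter> A0"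
  have "mods {c \<in> C. ?P c} G \<subseteq> {c \<in> mods C G. ?P c}" by (auto simp: mods_def)
  hence "mods {c \<in> C. ?P c} G = {}" using imp by blast
  moreover have "closed_class {c \<in> C. ?P c}"
  proof (rule closed_finite_condition[OF C, of "A0 \<union> A1"])
    fix c c' assume "c \<inter> (A0 \<union> A1) = c' \<inter> (A0 \<union> A1)"
    hence "c \<inter> A1 = c' \<inter> A1" "c \<inter> A0 = c' \<inter> A0" by blast+
    thus "?P c \<Longrightarrow> ?P c'" by simp
  qed (use A0 A1 in simp)
  ultimately obtain G0 where G0: "finite G0" "G0 \<subseteq> G" "mods {c \<in> C. ?P c} G0 = {}"
    using mods_compact[of "{c \<in> C. ?P c}" G] by meson
  then obtain G1 where G1: "G1 \<subseteq> G" "finite G1" "card G1 \<le> k" "mods C G1 \<subseteq> mods C G0"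
    using G unfolding compr_lits_def by blast
  show "\<exists>A2. finite A2 \<and> card A2 \<le> l + k \<and> (\<forall>c'\<in>C. c' \<inter> A2 = q \<inter> A2 \<longrightarrow> c' \<inter> A0 = q \<inter> A0)"
  proof (intro exI[of _ "A1 \<union> fst ` G1"] conjI ballI impI)
    show "finite (A1 \<union> fst ` G1)" using A1 G1 by simp
    show "card (A1 \<union> fst ` G1) \<le> l + k"
      using card_Un_le[of A1 "fst ` G1"] card_image_le[OF G1(2), of fst] A1(2) G1(3) by linarith
    fix c assume c: "c \<in> C" "c \<inter> (A1 \<union> fst ` G1) = q \<inter> (A1 \<union> fst ` G1)"
    have "(a \<in> c) = e" if "(a, e) \<in> G1" for a e
    proof -
      have "a \<in> fst ` G1" using that by force
      hence "(a \<in> c) = (a \<in> q)" using c(2) by blast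
      moreover have "(a \<in> q) = e" using q subsetD[OF G1(1) that] by (auto simp: mods_def)
      ultimately show ?thesis by simp
    qed
    hence "c \<in> mods C G1" using c(1) by (auto simp: mods_def)
    hence "c \<in> mods C G0" using G1(4) by blast
    moreover have "c \<inter> A1 = q \<inter> A1" using c(2) by blast
    ultimately show "c \<inter> A0 = q \<inter> A0" using G0(3) unfolding mods_def by blast
  qed
qed

section \<open>Exchange of literals for patterns, and the drop of the dimension\<close>

definition pat :: "'a set \<Rightarrow> 'a set \<Rightarrow> ('a \<times> bool) set" where
  "pat Z t = (\<lambda>z. (z, z \<in> t)) ` Z"

lemma mem_mods_pat: "t \<subseteq> Z \<Longrightarrow> c \<in> mods C (pat Z t) \<longleftrightarrow> c \<in> C \<and> c \<inter> Z = t"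
  by (auto simp: mods_def pat_def)

text \<open>The exchange argument of Chen, Cheng and Tang: since no larger set is shattered, each literal
  of \<open>G1\<close> is implied by some pattern on \<open>Z\<close>; a pattern implying many of them can replace them.\<close>

lemma exchange:
  assumes vc: "vc_le C D" and Z: "finite Z" "card Z = D" "shatters (mods C G) Z"
    and G1: "G1 \<subseteq> G" "finite G1" "card G1 \<le> 2 ^ D * D"
  shows "\<exists>t G2. t \<subseteq> Z \<and> G2 \<subseteq> G \<union> pat Z t \<and> finite G2 \<and> card G2 \<le> 2 ^ D * D \<and>
    mods C G2 \<subseteq> mods C (G1 \<union> pat Z t)"
\<comment> \<open>With room for \<open>D\<close> more literals any pattern can simply be added; only
  a nearly full \<open>G1\<close> requires an exchange.\<close>
proof (cases "card G1 + D \<le> 2 ^ D * D")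
  case True
  have "card (G1 \<union> pat Z {}) \<le> card G1 + card Z"
    using card_Un_le[of G1 "pat Z {}"] card_image_le[OF Z(1), of "\<lambda>z. (z, z \<in> {})"]
    unfolding pat_def by linarith
  hence "card (G1 \<union> pat Z {}) \<le> 2 ^ D * D" using True Z(2) by linarith
  moreover have "G1 \<union> pat Z {} \<subseteq> G \<union> pat Z {}" "finite (G1 \<union> pat Z {})"
    using G1 Z(1) by (auto simp: pat_def)
  ultimately show ?thesis by blast
next
  case False
  have "\<exists>t\<in>Pow Z. mods C (pat Z t) \<subseteq> mods C {g}" if g: "g \<in> G1" for g
  proof -
    obtain y e where ye: "g = (y, e)" by force
    have ev: "(y \<in> c) = e" if "c \<in> mods C G" for c using that g G1(1) ye by (auto simp: mods_def)
    have "y \<notin> Z"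
    proof
      assume "y \<in> Z"
      then obtain c where "c \<in> mods C G" "c \<inter> Z = (if e then {} else {y})"
        using Z(3) unfolding shatters_def by (metis empty_subsetI empty_subsetI insert_subsetI)
      thus False using ev \<open>y \<in> Z\<close> by (auto split: if_splits)
    qed
    hence "\<not> shatters C (insert y Z)" using vc Z unfolding vc_le_def
      by (metis card_insert_disjoint finite_insert not_less_eq_eq order_refl)
    \<comment> \<open>A trace \<open>s\<close> missing from \<open>C\<close> yields an implication:
      some member of \<open>mods C G\<close> realizes \<open>s\<close> on \<open>Z\<close>, so
      \<open>s\<close> must be wrong at \<open>y\<close>, and every member of \<open>C\<close> with
      the pattern \<open>s \<inter> Z\<close> takes the value \<open>e\<close> there.\<close>
    then obtain s where s: "s \<subseteq> insert y Z" "\<And>c. c \<in> C \<Longrightarrow> c \<inter> insert y Z \<noteq> s"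
      unfolding shatters_def by blast
    obtain c where c: "c \<in> mods C G" "c \<inter> Z = s \<inter> Z" using Z(3) unfolding shatters_def
      by (metis inf_le2)
    have "(y \<in> s) \<noteq> e"
    proof
      assume "(y \<in> s) = e"
      hence "c \<inter> insert y Z = s" using ev[OF c(1)] c(2) s(1) by blast
      thus False using s(2) c(1) mods_subset by blast
    qed
    have "mods C (pat Z (s \<inter> Z)) \<subseteq> mods C {g}"
    proof
      fix c' assume "c' \<in> mods C (pat Z (s \<inter> Z))"
      hence c': "c' \<in> C" "c' \<inter> Z = s \<inter> Z" by (simp_all add: mem_mods_pat)
      hence "(y \<in> c') \<noteq> (y \<in> s)" using s by blast
      thus "c' \<in> mods C {g}" using c'(1) \<open>(y \<in> s) \<noteq> e\<close> ye by (auto simp: mods_def)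
    qed
    thus ?thesis by blast
  qed
  hence "\<forall>g\<in>G1. \<exists>t. t \<in> Pow Z \<and> mods C (pat Z t) \<subseteq> mods C {g}" by blast
  from bchoice[OF this] obtain \<tau>
    where \<tau>: "\<And>g. g \<in> G1 \<Longrightarrow> \<tau> g \<in> Pow Z \<and> mods C (pat Z (\<tau> g)) \<subseteq> mods C {g}" by blast
  \<comment> \<open>Pigeonhole over \<open>2 ^ D\<close> patterns: fewer than \<open>D\<close>
    literals for each would make at most \<open>2 ^ D * (D - 1)\<close>, and
    \<open>D < 2 ^ D\<close> would leave room for \<open>D\<close> more.\<close>
  have "\<exists>t\<in>Pow Z. D \<le> card {g \<in> G1. \<tau> g = t}"
  proof (rule ccontr)
    assume "\<not> ?thesis"
    hence lt: "\<And>t. t \<in> Pow Z \<Longrightarrow> card {g \<in> G1. \<tau> g = t} < D" by (meson not_le)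
    have "D > 0" using lt[of "{}"] by simp
    have small: "card {g \<in> G1. \<tau> g = t} \<le> D - 1" if "t \<in> Pow Z" for t
      using lt[OF that] by linarith
    have "G1 = (\<Union>t\<in>Pow Z. {g \<in> G1. \<tau> g = t})" using \<tau> by blast
    hence "card G1 \<le> (\<Sum>t\<in>Pow Z. card {g \<in> G1. \<tau> g = t})"
      using card_UN_le[of "Pow Z" "\<lambda>t. {g \<in> G1. \<tau> g = t}"] Z(1) by simp
    also have "\<dots> \<le> card (Pow Z) * (D - 1)" using sum_bounded_above[OF small, of "Pow Z"] by simp
    also have "\<dots> = 2 ^ D * (D - 1)" using Z by (simp add: card_Pow)
    finally have "card G1 + D \<le> 2 ^ D * (D - 1) + 2 ^ D"
      using less_exp[of D] by linarith
    also have "\<dots> = 2 ^ D * D" using \<open>D > 0\<close> by (cases D) auto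
    finally show False using False by simp
  qed
  then obtain t where t: "t \<subseteq> Z" "D \<le> card {g \<in> G1. \<tau> g = t}" by auto
  \<comment> \<open>The literals implied by the pattern \<open>t\<close>, at least \<open>D\<close>
    of them, leave; the \<open>D\<close> literals of the pattern enter.\<close>
  let ?G' = "{g \<in> G1. \<tau> g \<noteq> t}" and ?Gt = "{g \<in> G1. \<tau> g = t}"
  have "card G1 = card ?G' + card ?Gt"
    using G1(2) by (subst card_Un_disjoint[symmetric]) (auto intro: arg_cong[of _ _ card])
  moreover have "card (?G' \<union> pat Z t) \<le> card ?G' + D"
    using card_Un_le[of ?G' "pat Z t"] card_image_le[OF Z(1), of "\<lambda>z. (z, z \<in> t)"] Z(2)
    unfolding pat_def by linarith
  ultimately have "card (?G' \<union> pat Z t) \<le> 2 ^ D * D" using t(2) G1(3) by linarith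
  moreover have "mods C (?G' \<union> pat Z t) \<subseteq> mods C (G1 \<union> pat Z t)"
  proof
    fix c assume c: "c \<in> mods C (?G' \<union> pat Z t)"
    hence "c \<in> mods C (pat Z t)" using mods_antimono[of "pat Z t"] by blast
    hence "c \<in> mods C {g}" if "g \<in> ?Gt" for g using \<tau> that by blast
    moreover have "c \<in> mods C ?G'" using c mods_antimono[of ?G'] by blast
    ultimately have "c \<in> mods C G1" by (simp add: mods_def) blast
    thus "c \<in> mods C (G1 \<union> pat Z t)" using c by (auto simp: mods_def)
  qed
  ultimately show ?thesis using t(1) G1 Z(1)
    by (intro exI[of _ t] exI[of _ "?G' \<union> pat Z t"]) (auto simp: pat_def)
qed

text \<open>If \<open>Suc d\<close> points were shattered, some pattern on them could be added to
  \<open>G\<close> without loss of compressibility. By maximality it would already belong to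
  \<open>G\<close>, and then the trace on these points would be fixed.\<close>

lemma vc_le_maximal:
  assumes vc: "vc_le C (Suc d)" and G: "G \<in> compr_lits C (2 ^ Suc d * Suc d)"
    and max: "\<And>H. H \<in> compr_lits C (2 ^ Suc d * Suc d) \<Longrightarrow> G \<subseteq> H \<Longrightarrow> H = G"
  shows "vc_le (mods C G) d"
proof (rule vc_leI_card, rule notI)
  fix Z assume Z: "finite Z" "card Z = Suc d" and sh: "shatters (mods C G) Z"
  let ?k = "2 ^ Suc d * Suc d"
  have "\<exists>t\<subseteq>Z. \<forall>G0. finite G0 \<longrightarrow> G0 \<subseteq> G \<longrightarrow> (\<exists>G2\<subseteq>G \<union> pat Z t. finite G2 \<and> card G2 \<le> ?k \<and>
    mods C G2 \<subseteq> mods C (G0 \<union> pat Z t))"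
  \<comment> \<open>One pattern must serve all finite parts of \<open>G\<close> at once: the
    obstructions \<open>g t\<close> to the finitely many patterns are merged into a single finite
    part, to which the exchange applies.\<close>
  proof (rule ccontr)
    assume "\<not> ?thesis"
    then obtain g where g: "\<And>t. t \<subseteq> Z \<Longrightarrow> finite (g t) \<and> g t \<subseteq> G \<and>
      \<not> (\<exists>G2\<subseteq>G \<union> pat Z t. finite G2 \<and> card G2 \<le> ?k \<and> mods C G2 \<subseteq> mods C (g t \<union> pat Z t))"
      by meson
    let ?G0 = "\<Union>t\<in>Pow Z. g t"
    have "finite ?G0" "?G0 \<subseteq> G" using g Z(1) by auto
    then obtain G1 where G1: "G1 \<subseteq> G" "finite G1" "card G1 \<le> ?k" "mods C G1 \<subseteq> mods C ?G0"
      using G unfolding compr_lits_def by blast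
    obtain t G2 where t: "t \<subseteq> Z" "G2 \<subseteq> G \<union> pat Z t" "finite G2" "card G2 \<le> ?k"
      "mods C G2 \<subseteq> mods C (G1 \<union> pat Z t)"
      using exchange[OF vc Z sh G1(1-3)] by blast
    have "mods C G1 \<subseteq> mods C (g t)"
      using G1(4) mods_antimono[of "g t" ?G0 C] t(1) by blast
    hence "mods C (G1 \<union> pat Z t) \<subseteq> mods C (g t \<union> pat Z t)"
      unfolding mods_Un by (simp add: mods_def subset_iff)
    hence "mods C G2 \<subseteq> mods C (g t \<union> pat Z t)" using t(5) by (rule order_trans[rotated])
    thus False using g[OF t(1)] t(2-4) by meson
  qed
  then obtain t where t: "t \<subseteq> Z" and ext: "\<And>G0. finite G0 \<Longrightarrow> G0 \<subseteq> G \<Longrightarrow>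
    \<exists>G2\<subseteq>G \<union> pat Z t. finite G2 \<and> card G2 \<le> ?k \<and> mods C G2 \<subseteq> mods C (G0 \<union> pat Z t)" by blast
  have "G \<union> pat Z t \<in> compr_lits C ?k"
    unfolding compr_lits_def
  proof (intro CollectI conjI allI impI)
    obtain c where "c \<in> mods C G" "c \<inter> Z = t" using sh t unfolding shatters_def by blast
    thus "mods C (G \<union> pat Z t) \<noteq> {}" using t by (auto simp: mods_Un mem_mods_pat)
    fix G0 assume G0: "finite G0" "G0 \<subseteq> G \<union> pat Z t"
    have "mods C ((G0 \<inter> G) \<union> pat Z t) \<subseteq> mods C G0" by (rule mods_antimono) (use G0 in auto)
    thus "\<exists>G1\<subseteq>G \<union> pat Z t. finite G1 \<and> card G1 \<le> ?k \<and> mods C G1 \<subseteq> mods C G0"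
      using ext[of "G0 \<inter> G"] G0 by (meson finite_Int inf_le2 order_trans)
  qed
  hence "pat Z t \<subseteq> G" using max by blast
  hence "mods C G \<subseteq> mods C (pat Z t)" by (rule mods_antimono)
  hence all: "c \<inter> Z = t" if "c \<in> mods C G" for c
    using that mem_mods_pat[OF t, of c C] by blast
  have "Z \<noteq> {}" using Z by auto
  then obtain t' where "t' \<subseteq> Z" "t' \<noteq> t" by (metis empty_subsetI order_refl)
  then obtain c where "c \<in> mods C G" "c \<inter> Z = t'" using sh unfolding shatters_def by meson
  thus False using all \<open>t' \<noteq> t\<close> by simp
qed

text \<open>In dimension 0 two distinct members would shatter a point at which they differ, so the
  only member is compressed by no points at all.\<close>

theorem compressible_density:
  assumes "closed_class C" "C \<noteq> {}" "vc_le C d"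
  shows "\<exists>q\<in>C. compr C (K_dens d) q"
  using assms
proof (induction d arbitrary: C)
  case 0
  then obtain q where q: "q \<in> C" by blast
  have "c = q" if "c \<in> C" for c
  proof (rule ccontr)
    assume "c \<noteq> q"
    then obtain a where "(a \<in> c) \<noteq> (a \<in> q)" by blast
    hence "shatters C {a}" unfolding shatters_def using q that
      by (auto simp: subset_singleton_iff)
    hence "card {a} \<le> 0" using 0(3) unfolding vc_le_def by (meson finite.emptyI finite_insert)
    thus False by simp
  qed
  hence "compr C (K_dens 0) q" unfolding compr_def by (auto intro!: exI[of _ "{}"])
  thus ?case using q by blast
next
  case (Suc d)
  obtain G where G: "G \<in> compr_lits C (2 ^ Suc d * Suc d)"
    and max: "\<And>H. H \<in> compr_lits C (2 ^ Suc d * Suc d) \<Longrightarrow> G \<subseteq> H \<Longrightarrow> H = G"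
    using compr_lits_maximal[OF Suc(2,3)] by meson
  have "mods C G \<noteq> {}" using G by (simp add: compr_lits_def)
  then obtain q where "q \<in> mods C G" "compr (mods C G) (K_dens d) q"
    using Suc.IH[OF closed_mods[OF Suc(2)] _ vc_le_maximal[OF Suc(4) G max]] by blast
  thus ?case using compr_trans[OF Suc(2) G] mods_subset by (metis K_dens.simps(2) subsetD)
qed

section \<open>Generic patterns along ultrafilters\<close>

text \<open>\<open>gen u w C\<close>: for generic points \<open>a\<^sub>1, a\<^sub>2, \<dots>\<close> chosen successively along the ultrafilters
  \<open>u j\<close> prescribed by the word \<open>w\<close>, some member of \<open>C\<close> has the truth values prescribed by \<open>w\<close> at
  them.  Model-theoretically, the points form a Morley sequence of the types given by the \<open>u j\<close>.\<close>

primrec gen :: "(nat \<Rightarrow> 'a filter) \<Rightarrow> (nat \<times> bool) list \<Rightarrow> 'a set set \<Rightarrow> bool" where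
  "gen u [] C \<longleftrightarrow> C \<noteq> {}"
| "gen u (l # w) C \<longleftrightarrow> eventually (\<lambda>a. gen u w {c \<in> C. (a \<in> c) = snd l}) (u (fst l))"

lemma gen_mono: "gen u w C \<Longrightarrow> C \<subseteq> C' \<Longrightarrow> gen u w C'"
proof (induction w arbitrary: C C')
  case (Cons l w)
  have "gen u w {c \<in> C. (a \<in> c) = snd l} \<Longrightarrow> gen u w {c \<in> C'. (a \<in> c) = snd l}" for a
    by (erule Cons.IH) (use Cons.prems in blast)
  then show ?case using Cons.prems(1) by (simp add: eventually_mono)
qed auto

locale ultra_family =
  fixes u :: "nat \<Rightarrow> 'a filter" and N :: nat
  assumes ultra_u: "j < N \<Longrightarrow> ultra (u j)"
begin

abbreviation valid :: "(nat \<times> bool) list \<Rightarrow> bool" where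
  "valid w \<equiv> fst ` set w \<subseteq> {..<N}"

text \<open>Each ultrafilter decides the disjunction. Hence the classes not admitting
  \<open>w\<close> form an ideal.\<close>

lemma gen_Un: "valid w \<Longrightarrow> gen u w (C \<union> C') \<Longrightarrow> gen u w C \<or> gen u w C'"
proof (induction w arbitrary: C C')
  case (Cons l w)
  have "{c \<in> C \<union> C'. P c} = {c \<in> C. P c} \<union> {c \<in> C'. P c}" for P by blast
  hence *: "gen u w {c \<in> C. (a \<in> c) = snd l} \<or> gen u w {c \<in> C'. (a \<in> c) = snd l}"
    if "gen u w {c \<in> C \<union> C'. (a \<in> c) = snd l}" for a
    using that Cons by simp
  have "eventually (\<lambda>a. gen u w {c \<in> C \<union> C'. (a \<in> c) = snd l}) (u (fst l))"
    using Cons.prems(2) by simp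
  hence "eventually (\<lambda>a. gen u w {c \<in> C. (a \<in> c) = snd l} \<or> gen u w {c \<in> C'. (a \<in> c) = snd l})
      (u (fst l))"
    by (rule eventually_mono) (rule *)
  thus ?case using ultra_disj[OF ultra_u] Cons.prems(1) by simp
qed auto

text \<open>A skipped letter costs nothing: some point exists for it, and the condition there can be
  forgotten.\<close>

lemma gen_subseq: "subseq w' w \<Longrightarrow> valid w \<Longrightarrow> gen u w C \<Longrightarrow> gen u w' C"
proof (induction arbitrary: C rule: list_emb.induct)
  case (list_emb_Nil w)
  then show ?case
  proof (induction w arbitrary: C)
    case (Cons l w)
    then obtain a where "gen u w {c \<in> C. (a \<in> c) = snd l}"
      using ultra_happens[OF ultra_u] by fastforce
    moreover have "valid w" using Cons.prems(1) by simp
    ultimately have "gen u [] {c \<in> C. (a \<in> c) = snd l}" by (intro Cons.IH)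
    then show ?case by auto
  qed
next
  case (list_emb_Cons w' w l)
  then obtain a where "gen u w {c \<in> C. (a \<in> c) = snd l}"
    using ultra_happens[OF ultra_u] by fastforce
  hence "gen u w' {c \<in> C. (a \<in> c) = snd l}" using list_emb_Cons by simp
  then show ?case by (rule gen_mono) blast
next
  case (list_emb_Cons2 x y w' w)
  then have "gen u w' {c \<in> C. (a \<in> c) = snd x}" if "gen u w {c \<in> C. (a \<in> c) = snd x}" for a
    using that by simp
  then show ?case using list_emb_Cons2.hyps list_emb_Cons2.prems(2) by (simp add: eventually_mono)
qed

lemma gen_nonempty: "valid w \<Longrightarrow> gen u w C \<Longrightarrow> C \<noteq> {}"
  using gen_subseq[of "[]" w C] by simp

text \<open>The properties whose failure does not admit \<open>w\<close> form a proper filter. An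
  ultrafilter below it contains only properties compatible with \<open>w\<close>, and
  \<open>c\<close> is its limit.\<close>

lemma gen_compact:
  assumes "valid w" "gen u w C" "closed_class C"
  shows "\<exists>c\<in>C. \<forall>B. finite B \<longrightarrow> gen u w {c' \<in> C. c' \<inter> B = c \<inter> B}"
proof -
  let ?ev = "\<lambda>P. \<not> gen u w {c \<in> C. \<not> P c}"
  define F where "F = Abs_filter ?ev"
  have evF: "eventually P F \<longleftrightarrow> ?ev P" for P
    unfolding F_def
  proof (rule eventually_Abs_filter, rule is_filter.intro)
    show "?ev (\<lambda>x. True)" using gen_nonempty[OF assms(1), of "{}"] by auto
  next
    fix P Q assume "?ev P" "?ev Q"
    moreover have "{c \<in> C. \<not> (P c \<and> Q c)} = {c \<in> C. \<not> P c} \<union> {c \<in> C. \<not> Q c}" by auto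
    ultimately show "?ev (\<lambda>x. P x \<and> Q x)"
      using gen_Un[OF assms(1), of "{c \<in> C. \<not> P c}" "{c \<in> C. \<not> Q c}"] by auto
  next
    fix P Q assume "\<forall>x. P x \<longrightarrow> Q x" "?ev P"
    moreover have "gen u w {c \<in> C. \<not> Q c} \<Longrightarrow> gen u w {c \<in> C. \<not> P c}"
      by (erule gen_mono) (use \<open>\<forall>x. P x \<longrightarrow> Q x\<close> in blast)
    ultimately show "?ev Q" by blast
  qed
  have "F \<noteq> bot" using assms(2) evF[of "\<lambda>x. False"] by (simp add: trivial_limit_def)
  then obtain U where U: "ultra U" "U \<le> F" using ultra_exists by blast
  have genU: "gen u w {c \<in> C. P c}" if "eventually P U" for P
  proof (rule ccontr)
    assume "\<not> ?thesis"
    hence "eventually (\<lambda>c. \<not> P c) F" by (simp add: evF)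
    hence "eventually (\<lambda>c. \<not> P c) U" using U(2) by (rule filter_leD[rotated])
    thus False using that ultra_not_eventually[OF U(1), of P] by simp
  qed
  have *: "gen u w {c' \<in> C. c' \<inter> B = ulim U \<inter> B}" if "finite B" for B
    using genU[OF eventually_ulim[OF U(1) that]] .
  have "\<exists>c'\<in>C. c' \<inter> B = ulim U \<inter> B" if "finite B" for B
    using gen_nonempty[OF assms(1) *[OF that]] by blast
  hence "ulim U \<in> C" using assms(3) by (simp add: closed_class_def)
  thus ?thesis using * by blast
qed

text \<open>Points for the prefix \<open>s\<close> are fixed one by one. Along an ultrafilter, not
  admitting a word is as generic as admitting one, so the same points keep \<open>w\<close> possible
  and the finitely many words of \<open>V\<close> impossible.\<close>

lemma gen_split:
  assumes "valid s" "gen u (s @ w) C" "finite V" "\<And>v. v \<in> V \<Longrightarrow> \<not> gen u (s @ v) C"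
  shows "\<exists>G. finite G \<and> card G \<le> length s \<and> gen u w (mods C G) \<and> (\<forall>v\<in>V. \<not> gen u v (mods C G))"
  using assms
proof (induction s arbitrary: C)
  case Nil
  then show ?case by (intro exI[of _ "{}"]) (simp add: mods_def)
next
  case (Cons l s)
  let ?C = "\<lambda>a. {c \<in> C. (a \<in> c) = snd l}"
  have ul: "ultra (u (fst l))" using Cons.prems(1) ultra_u by simp
  have "eventually (\<lambda>a. \<not> gen u (s @ v) (?C a)) (u (fst l))" if "v \<in> V" for v
    using Cons.prems(4)[OF that] by (simp add: ultra_not_eventually[OF ul])
  hence "eventually (\<lambda>a. \<forall>v\<in>V. \<not> gen u (s @ v) (?C a)) (u (fst l))"
    using Cons.prems(3) by (simp add: eventually_ball_finite)
  moreover have "eventually (\<lambda>a. gen u (s @ w) (?C a)) (u (fst l))" using Cons.prems(2) by simp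
  ultimately obtain a where a: "\<forall>v\<in>V. \<not> gen u (s @ v) (?C a)" "gen u (s @ w) (?C a)"
    using ultra_happens[OF ul eventually_conj] by blast
  obtain G where G: "finite G" "card G \<le> length s" "gen u w (mods (?C a) G)"
    "\<forall>v\<in>V. \<not> gen u v (mods (?C a) G)"
    using Cons.IH[of "?C a"] Cons.prems(1,3) a by auto
  show ?case
    by (rule exI[of _ "insert (a, snd l) G"])
      (use G card_insert_le_m1[of "Suc (length s)" G "(a, snd l)"] in \<open>simp add: mods_insert\<close>)
qed

text \<open>The failure of a word of zeros is witnessed by generically chosen points, which can be
  taken outside \<open>q\<close> as \<open>q\<close> is generically zero. Agreement with
  \<open>q\<close> on \<open>B\<close> then excludes every member of \<open>C\<close>.\<close>

lemma not_gen_points: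
  assumes "valid w" "\<not> gen u w C" "\<forall>l\<in>set w. \<not> snd l"
    and "\<And>j. j < N \<Longrightarrow> eventually (\<lambda>a. a \<notin> q) (u j)"
  shows "\<exists>B. finite B \<and> card B \<le> length w \<and> B \<inter> q = {} \<and> (\<forall>c\<in>C. c \<inter> B \<noteq> {})"
  using assms
proof (induction w arbitrary: C)
  case Nil
  then show ?case by (intro exI[of _ "{}"]) auto
next
  case (Cons l w)
  have ul: "ultra (u (fst l))" using Cons.prems(1) ultra_u by simp
  have "eventually (\<lambda>a. \<not> gen u w {c \<in> C. a \<notin> c}) (u (fst l))"
    using Cons.prems(2,3) by (simp add: ultra_not_eventually[OF ul])
  moreover have "eventually (\<lambda>a. a \<notin> q) (u (fst l))" using Cons.prems(1,4) by simp
  ultimately obtain a where a: "\<not> gen u w {c \<in> C. a \<notin> c}" "a \<notin> q"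
    using ultra_happens[OF ul eventually_conj] by blast
  obtain B where B: "finite B" "card B \<le> length w" "B \<inter> q = {}" "\<forall>c\<in>{c \<in> C. a \<notin> c}. c \<inter> B \<noteq> {}"
    using Cons.IH[of "{c \<in> C. a \<notin> c}"] Cons.prems(1,3,4) a by auto
  show ?case
    by (rule exI[of _ "insert a B"])
      (use B a(2) card_insert_le_m1[of "Suc (length w)" B a] in auto)
qed

lemma gen_zeros:
  assumes "{} \<in> C" "\<forall>l\<in>set w. \<not> snd l"
  shows "gen u w C"
  using assms by (induction w arbitrary: C) (auto intro!: always_eventually)

text \<open>Finitely many generic conditions hold jointly, so one sequence of points serves all
  patterns. Applied to all patterns of one length, this produces a shattered set.\<close>

lemma gen_simultaneous:
  assumes "j < N" "finite I" "\<And>i. i \<in> I \<Longrightarrow> length (f i) = m"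
    and "\<And>i. i \<in> I \<Longrightarrow> gen u (map (Pair j) (f i)) (C i)"
  shows "\<exists>as. length as = m \<and> (\<forall>i\<in>I. \<exists>c\<in>C i. map (\<lambda>a. a \<in> c) as = f i)"
  using assms(3,4)
proof (induction m arbitrary: f C)
  case 0
  then show ?case by (fastforce intro: exI[of _ "[]"])
next
  case (Suc m)
  have f: "f i = hd (f i) # tl (f i)" if "i \<in> I" for i
    using Suc.prems(1)[OF that] by (cases "f i") auto
  let ?C = "\<lambda>a i. {c \<in> C i. (a \<in> c) = hd (f i)}"
  have "eventually (\<lambda>a. gen u (map (Pair j) (tl (f i))) (?C a i)) (u j)" if "i \<in> I" for i
    using Suc.prems(2)[OF that] by (subst (asm) f[OF that]) simp
  hence "eventually (\<lambda>a. \<forall>i\<in>I. gen u (map (Pair j) (tl (f i))) (?C a i)) (u j)"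
    using assms(2) by (simp add: eventually_ball_finite)
  then obtain a where a: "\<And>i. i \<in> I \<Longrightarrow> gen u (map (Pair j) (tl (f i))) (?C a i)"
    using ultra_happens[OF ultra_u[OF assms(1)]] by blast
  obtain as where as: "length as = m" "\<And>i. i \<in> I \<Longrightarrow> \<exists>c\<in>?C a i. map (\<lambda>a. a \<in> c) as = tl (f i)"
    using Suc.IH[of "\<lambda>i. tl (f i)" "?C a"] Suc.prems(1) a by auto
  have "\<exists>c\<in>C i. map (\<lambda>a. a \<in> c) (a # as) = f i" if i: "i \<in> I" for i
  proof -
    obtain c where "c \<in> C i" "(a \<in> c) = hd (f i)" "map (\<lambda>a. a \<in> c) as = tl (f i)"
      using as(2)[OF i] by blast
    thus ?thesis using f[OF i] by (intro bexI[of _ c]) simp_all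
  qed
  thus ?case using as(1) by (intro exI[of _ "a # as"]) simp
qed

end

section \<open>Alternating patterns and their bounded length\<close>

lemma shatters_list:
  assumes "\<And>e. length e = length as \<Longrightarrow> \<exists>c\<in>C. map (\<lambda>a. a \<in> c) as = e"
  shows "shatters C (set as) \<and> card (set as) = length as"
proof
  show "shatters C (set as)"
    unfolding shatters_def
  proof (intro allI impI)
    fix D assume "D \<subseteq> set as"
    obtain c where "c \<in> C" "map (\<lambda>a. a \<in> c) as = map (\<lambda>a. a \<in> D) as"
      using assms[of "map (\<lambda>a. a \<in> D) as"] by auto
    thus "\<exists>S\<in>C. S \<inter> set as = D" using \<open>D \<subseteq> set as\<close> by (intro bexI[of _ c]) auto
  qed
  have "distinct as"
    unfolding distinct_conv_nth
  proof (intro allI impI notI)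
    fix i k assume *: "i < length as" "k < length as" "i \<noteq> k" "as ! i = as ! k"
    obtain c where "map (\<lambda>a. a \<in> c) as = map (\<lambda>n. n = i) [0..<length as]"
      using assms[of "map (\<lambda>n. n = i) [0..<length as]"] by auto
    hence "map (\<lambda>a. a \<in> c) as ! n = map (\<lambda>n. n = i) [0..<length as] ! n" for n by simp
    from this[of i] this[of k] show False using * by simp
  qed
  thus "card (set as) = length as" by (rule distinct_card)
qed

definition alt :: "nat list \<Rightarrow> (nat \<times> bool) list" where
  "alt js = concat (map (\<lambda>j. [(j, True), (j, False)]) js)"

lemma alt_simps [simp]: "alt [] = []" "alt (j # js) = (j, True) # (j, False) # alt js"
  "alt (js @ js') = alt js @ alt js'" "length (alt js) = 2 * length js" "fst ` set (alt js) = set js"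
  by (auto simp: alt_def length_concat o_def sum_list_triv image_UN)

lemma subseq_alt: "subseq js js' \<Longrightarrow> subseq (alt js) (alt js')"
  by (induction rule: list_emb.induct) auto

text \<open>Every block of the alternating word offers both truth values; one letter is taken from
  each.\<close>

lemma subseq_alt_replicate: "subseq (map (Pair j) e) (alt (replicate (length e) j))"
proof (induction e)
  case (Cons x e)
  then show ?case by (cases x) auto
qed simp

lemma exists_count_gt:
  assumes "set js \<subseteq> {..<N}" "N * d < length js"
  shows "\<exists>j<N. d < length (filter ((=) j) js)"
proof (rule ccontr)
  assume "\<not> ?thesis"
  hence *: "\<And>j. j < N \<Longrightarrow> count_list js j \<le> d"
    by (metis (no_types) count_list_eq_length_filter not_le)
  have "length js = (\<Sum>j<N. count_list js j)"
    using sum_count_set[OF assms(1)] by simp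
  also have "\<dots> \<le> (\<Sum>j<N. d)" by (rule sum_mono) (use * in auto)
  finally show False using assms(2) by simp
qed

context ultra_family
begin

text \<open>Some \<open>j\<close> occurs more than \<open>d\<close> times. The alternations along
  this one ultrafilter contain all patterns of that length as subsequences, and realizing them at
  common points shatters more than \<open>d\<close> points.\<close>

lemma alt_bound:
  assumes vc: "vc_le C d" and js: "set js \<subseteq> {..<N}" and gen: "gen u (alt js) C"
  shows "length js \<le> N * d"
proof (rule ccontr)
  assume "\<not> ?thesis"
  then obtain j where j: "j < N" "d < length (filter ((=) j) js)"
    using exists_count_gt[OF js, of d] by auto
  define m where "m = length (filter ((=) j) js)"
  have "filter ((=) j) js = replicate m j"
    unfolding m_def by (rule replicate_length_same[symmetric]) simp
  hence "subseq (alt (replicate m j)) (alt js)"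
    using subseq_alt subseq_filter_left by metis
  hence genm: "gen u (alt (replicate m j)) C" using gen_subseq gen js by simp
  have "\<exists>as. length as = m \<and> (\<forall>e\<in>{e. length e = m}. \<exists>c\<in>C. map (\<lambda>a. a \<in> c) as = e)"
  proof (rule gen_simultaneous[OF j(1), of _ "\<lambda>e. e" m "\<lambda>_. C"])
    show "finite {e :: bool list. length e = m}"
      using finite_lists_length_eq[of "UNIV :: bool set" m] by simp
  next
    fix e :: "bool list" assume "e \<in> {e. length e = m}"
    hence "subseq (map (Pair j) e) (alt (replicate m j))"
      using subseq_alt_replicate[of j e] by simp
    thus "gen u (map (Pair j) e) C"
      by (rule gen_subseq) (use genm j(1) in auto)
  qed simp
  then obtain as where "length as = m" "\<And>e. length e = m \<Longrightarrow> \<exists>c\<in>C. map (\<lambda>a. a \<in> c) as = e" by auto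
  hence "shatters C (set as) \<and> card (set as) = m" using shatters_list by metis
  thus False using vc j(2) unfolding vc_le_def m_def by (metis finite_set not_le)
qed

section \<open>Compressible members that are generically zero\<close>

definition zeros :: "nat \<Rightarrow> (nat \<times> bool) list" where
  "zeros L = concat (replicate L (map (\<lambda>j. (j, False)) [0..<N]))"

lemma zeros_simps [simp]: "zeros 0 = []" "zeros (Suc L) = map (\<lambda>j. (j, False)) [0..<N] @ zeros L"
  "length (zeros L) = L * N"
  by (auto simp: zeros_def length_concat sum_list_replicate)

lemma set_zeros: "set (zeros L) \<subseteq> (\<lambda>j. (j, False)) ` {..<N}"
  by (auto simp: zeros_def)

lemma valid_zeros [simp]: "valid (zeros L)"
  using set_zeros by fastforce

text \<open>Among the generic patterns \<open>alt js\<close> that can be followed by generic zeros, take one of maximal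
  length.  Members of \<open>C\<close> with this pattern that still admit generic zeros afterwards cannot be
  generically one along any \<open>u j\<close>, as this would lengthen the pattern.\<close>

theorem strong_density:
  assumes C: "closed_class C" and vc: "vc_le C d" and "{} \<in> C"
  shows "\<exists>q\<in>C. compr C (K_dens d + 2 * (N * d) + (N * d + 1) * N) q \<and>
    (\<forall>j<N. eventually (\<lambda>a. a \<notin> q) (u j))"
proof -
  \<comment> \<open>One more than the bound in \<open>alt_bound\<close>, so that
    \<open>?P ?L\<close> is impossible. Each alternation is paid for with one round of zeros, which
    supplies its letter \<open>(j, False)\<close>.\<close>
  let ?L = "N * d + 1"
  let ?P = "\<lambda>i. \<exists>js. length js = i \<and> set js \<subseteq> {..<N} \<and> gen u (alt js @ zeros (?L - i)) C"
  have "?P 0" using gen_zeros[OF \<open>{} \<in> C\<close>, of "zeros ?L"] set_zeros[of ?L] by fastforce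
  moreover have "\<not> ?P ?L" using alt_bound[OF vc] by fastforce
  ultimately obtain i where i: "i < ?L" "?P i" "\<not> ?P (Suc i)"
    using ex_least_nat_less[of "\<lambda>i. \<not> ?P i" ?L] by blast
  then obtain js where js: "length js = i" "set js \<subseteq> {..<N}" "gen u (alt js @ zeros (?L - i)) C"
    by blast
  define M where "M = ?L - Suc i"
  have L: "?L - i = Suc M" using i(1) by (simp add: M_def)
  let ?w = "zeros (Suc M)" and ?v = "\<lambda>j. (j, True) # (j, False) # zeros M"
  have "\<not> gen u (alt js @ v) C" if v: "v \<in> ?v ` {..<N}" for v
  proof
    assume *: "gen u (alt js @ v) C"
    obtain j where "j < N" "v = ?v j" using v by blast
    hence "gen u (alt (js @ [j]) @ zeros (?L - Suc i)) C" using * by (simp add: M_def)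
    moreover have "length (js @ [j]) = Suc i" "set (js @ [j]) \<subseteq> {..<N}"
      using js \<open>j < N\<close> by auto
    ultimately show False using i(3) by blast
  qed
  then obtain G where G: "finite G" "card G \<le> 2 * i" "gen u ?w (mods C G)"
    and nv: "\<And>j. j < N \<Longrightarrow> \<not> gen u (?v j) (mods C G)"
    using gen_split[of "alt js" ?w C "?v ` {..<N}"] js L by auto
  let ?D = "mods C G"
  \<comment> \<open>Zeros are required in every neighbourhood of \<open>c\<close>, which makes
    \<open>E\<close> closed; \<open>gen_compact\<close> supplies a member.\<close>
  define E where "E = {c \<in> ?D. \<forall>B. finite B \<longrightarrow> gen u ?w {c' \<in> ?D. c' \<inter> B = c \<inter> B}}"
  have clD: "closed_class ?D" by (rule closed_mods[OF C])
  have "E \<noteq> {}" using gen_compact[OF valid_zeros G(3) clD] by (auto simp: E_def)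
  have "E \<subseteq> ?D" by (simp add: E_def)
  have genE: "gen u ?w {c' \<in> ?D. c' \<inter> B = c \<inter> B}" if "c \<in> E" "finite B" for c B
    using that by (simp add: E_def)
  have "closed_class E"
    unfolding closed_class_def
  proof (intro allI impI)
    fix c assume *: "\<forall>B. finite B \<longrightarrow> (\<exists>c'\<in>E. c' \<inter> B = c \<inter> B)"
    hence "\<exists>c'\<in>?D. c' \<inter> B = c \<inter> B" if "finite B" for B
      using that \<open>E \<subseteq> ?D\<close> by (meson subsetD)
    hence "c \<in> ?D" using clD by (simp add: closed_class_def)
    moreover have "gen u ?w {c' \<in> ?D. c' \<inter> B = c \<inter> B}" if B: "finite B" for B
    proof -
      obtain c' where "c' \<in> E" "c' \<inter> B = c \<inter> B" using * B by meson
      thus ?thesis using genE[OF _ B, of c'] by simp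
    qed
    ultimately show "c \<in> E" by (simp add: E_def)
  qed
  have "E \<subseteq> C" using \<open>E \<subseteq> ?D\<close> mods_subset by (rule order_trans)
  then obtain q where q: "q \<in> E" "compr E (K_dens d) q"
    using compressible_density[OF \<open>closed_class E\<close> \<open>E \<noteq> {}\<close> vc_le_mono[OF vc]] by blast
  have lim: "eventually (\<lambda>a. a \<notin> q) (u j)" if j: "j < N" for j
  proof (rule ccontr)
    assume "\<not> ?thesis"
    hence "eventually (\<lambda>a. a \<in> q) (u j)" using ultra_not_eventually[OF ultra_u[OF j], of "\<lambda>a. a \<notin> q"] by simp
    moreover have "gen u ((j, False) # zeros M) {c \<in> ?D. a \<in> c}" if "a \<in> q" for a
    proof (rule gen_subseq)
      have "gen u ?w {c' \<in> ?D. c' \<inter> {a} = q \<inter> {a}}" using genE[OF q(1)] by simp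
      thus "gen u ?w {c \<in> ?D. a \<in> c}" by (rule gen_mono) (use that in auto)
      have "subseq [(j, False)] (map (\<lambda>j. (j, False)) [0..<N])"
        using j by (simp add: subseq_singleton_left image_iff)
      thus "subseq ((j, False) # zeros M) ?w"
        using list_emb_append_mono[of "(=)" "[(j, False)]" _ "zeros M" "zeros M"] by simp
    qed (rule valid_zeros)
    ultimately have "gen u (?v j) ?D" by (simp add: eventually_mono)
    thus False using nv[OF j] by simp
  qed
  have "compr C (K_dens d + 2 * i + (?L - i) * N) q"
    unfolding compr_def
  proof (intro allI impI)
    fix A0 :: "'a set" assume A0: "finite A0"
    obtain A1 where A1: "finite A1" "card A1 \<le> K_dens d"
      and imp: "\<And>c. c \<in> E \<Longrightarrow> c \<inter> A1 = q \<inter> A1 \<Longrightarrow> c \<inter> A0 = q \<inter> A0"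
      using q(2) A0 unfolding compr_def by metis
    let ?X = "{c \<in> ?D. c \<inter> A1 = q \<inter> A1 \<and> c \<inter> A0 \<noteq> q \<inter> A0}"
    have "closed_class ?X"
    proof (rule closed_finite_condition[OF clD, of "A0 \<union> A1"])
      fix c c' assume "c \<inter> (A0 \<union> A1) = c' \<inter> (A0 \<union> A1)"
      hence "c \<inter> A1 = c' \<inter> A1" "c \<inter> A0 = c' \<inter> A0" by blast+
      thus "c \<inter> A1 = q \<inter> A1 \<and> c \<inter> A0 \<noteq> q \<inter> A0 \<Longrightarrow> c' \<inter> A1 = q \<inter> A1 \<and> c' \<inter> A0 \<noteq> q \<inter> A0" by simp
    qed (use A0 A1 in simp)
    have "\<not> gen u ?w ?X"
    proof
      assume "gen u ?w ?X"
      from gen_compact[OF valid_zeros this \<open>closed_class ?X\<close>]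
      obtain c where c: "c \<in> ?X" "\<forall>B. finite B \<longrightarrow> gen u ?w {c' \<in> ?X. c' \<inter> B = c \<inter> B}"
        by (elim bexE)
      have "gen u ?w {c' \<in> ?D. c' \<inter> B = c \<inter> B}" if "finite B" for B
        by (rule gen_mono[OF c(2)[rule_format, OF that]]) auto
      hence "c \<in> E" using c(1) by (simp add: E_def)
      thus False using imp[of c] c(1) by simp
    qed
    moreover have "\<forall>l\<in>set ?w. \<not> snd l" using set_zeros[of "Suc M"] by auto
    ultimately obtain B where B: "finite B" "card B \<le> length ?w" "B \<inter> q = {}"
      "\<forall>c\<in>?X. c \<inter> B \<noteq> {}"
      using not_gen_points[OF valid_zeros _ _ lim, of "Suc M" ?X] by meson
    show "\<exists>A2. finite A2 \<and> card A2 \<le> K_dens d + 2 * i + (?L - i) * N \<and>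
      (\<forall>c\<in>C. c \<inter> A2 = q \<inter> A2 \<longrightarrow> c \<inter> A0 = q \<inter> A0)"
    \<comment> \<open>\<open>A1\<close> compresses inside \<open>E\<close>, the points of
      \<open>G\<close> force membership in \<open>?D\<close>, and \<open>B\<close> excludes the
      counterexamples in \<open>?D\<close>.\<close>
    proof (intro exI[of _ "A1 \<union> fst ` G \<union> B"] conjI ballI impI)
      show "finite (A1 \<union> fst ` G \<union> B)" using A1 G B by simp
      have "card (fst ` G) \<le> 2 * i" using card_image_le[OF G(1), of fst] G(2) by linarith
      moreover have "card B \<le> (?L - i) * N" using B(2) unfolding L by simp
      ultimately show "card (A1 \<union> fst ` G \<union> B) \<le> K_dens d + 2 * i + (?L - i) * N"
        using card_Un_le[of A1 "fst ` G"] card_Un_le[of "A1 \<union> fst ` G" B] A1(2) by linarith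
      fix c assume c: "c \<in> C" "c \<inter> (A1 \<union> fst ` G \<union> B) = q \<inter> (A1 \<union> fst ` G \<union> B)"
      have "q \<in> ?D" using q(1) \<open>E \<subseteq> ?D\<close> by blast
      have "(a \<in> c) = e" if "(a, e) \<in> G" for a e
      proof -
        have "a \<in> fst ` G" using that by force
        hence "(a \<in> c) = (a \<in> q)" using c(2) by blast
        moreover have "(a \<in> q) = e" using \<open>q \<in> ?D\<close> that by (auto simp: mods_def)
        ultimately show ?thesis by simp
      qed
      hence "c \<in> ?D" using c(1) by (auto simp: mods_def)
      moreover have "c \<inter> A1 = q \<inter> A1" "c \<inter> B = {}" using c(2) B(3) by blast+
      ultimately show "c \<inter> A0 = q \<inter> A0" using B(4) by simp blast
    qed
  qed
  moreover have "K_dens d + 2 * i + (?L - i) * N \<le> K_dens d + 2 * (N * d) + ?L * N"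
    using i(1) by (intro add_mono mult_le_mono) auto
  ultimately have "compr C (K_dens d + 2 * (N * d) + ?L * N) q" by (rule compr_mono)
  moreover have "q \<in> C" using q(1) \<open>E \<subseteq> C\<close> by blast
  ultimately show ?thesis using lim by blast
qed

end

section \<open>The (p,q)-theorem\<close>

lemma shatters_superset: "shatters \<F> B \<Longrightarrow> \<exists>S\<in>\<F>. B \<subseteq> S"
  unfolding shatters_def by (metis inf.cobounded1 order_refl)

text \<open>Index \<open>2 ^ Suc d\<close> dually shattered sets by the subsets of
  \<open>{..<Suc d}\<close>. For each \<open>i\<close> some point lies in exactly those whose index
  contains \<open>i\<close>, and these \<open>Suc d\<close> points are shattered by
  \<open>C\<close>.\<close>

lemma dual_vc:
  assumes vc: "vc_le C d" and "F \<subseteq> C" "finite B"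
    and sh: "shatters (range (\<lambda>a. {s \<in> F. a \<in> s})) B"
  shows "card B < 2 ^ Suc d"
proof (rule ccontr)
  assume "\<not> ?thesis"
  then obtain B' where B': "B' \<subseteq> B" "card B' = 2 ^ Suc d"
    using obtain_subset_with_card_n[of "2 ^ Suc d" B] by (metis not_less)
  have finB': "finite B'" using B'(1) assms(3) finite_subset by blast
  have sh': "shatters (range (\<lambda>a. {s \<in> F. a \<in> s})) B'" using sh B'(1) by (rule shatters_subset)
  have "B' \<subseteq> F"
    using shatters_superset[OF sh'] by auto
  hence "B' \<subseteq> C" using assms(2) by blast
  let ?I = "{..<Suc d}"
  obtain \<beta> where \<beta>: "bij_betw \<beta> (Pow ?I) B'"
    using finite_same_card_bij[of "Pow ?I" B'] finB' B'(2) by (auto simp: card_Pow)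
  have inj\<beta>: "inj_on \<beta> (Pow ?I)" using \<beta> by (simp add: bij_betw_def)
  have im\<beta>: "\<beta> S \<in> B'" if "S \<subseteq> ?I" for S using \<beta> that by (auto simp: bij_betw_def)
  have "\<exists>a. \<forall>S\<subseteq>?I. a \<in> \<beta> S \<longleftrightarrow> i \<in> S" for i
  proof -
    have "\<beta> ` {S. S \<subseteq> ?I \<and> i \<in> S} \<subseteq> B'" using im\<beta> by blast
    then obtain T where T: "T \<in> range (\<lambda>a. {s \<in> F. a \<in> s})"
      "T \<inter> B' = \<beta> ` {S. S \<subseteq> ?I \<and> i \<in> S}"
      using sh' unfolding shatters_def by meson
    then obtain a where a: "{s \<in> F. a \<in> s} \<inter> B' = \<beta> ` {S. S \<subseteq> ?I \<and> i \<in> S}" by auto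
    hence "a \<in> \<beta> S \<longleftrightarrow> \<beta> S \<in> \<beta> ` {S. S \<subseteq> ?I \<and> i \<in> S}" if "S \<subseteq> ?I" for S
      using a im\<beta>[OF that] \<open>B' \<subseteq> F\<close> by blast
    moreover have "\<beta> S \<in> \<beta> ` {S. S \<subseteq> ?I \<and> i \<in> S} \<longleftrightarrow> i \<in> S" if "S \<subseteq> ?I" for S
      by (subst inj_on_image_mem_iff[OF inj\<beta>]) (use that in auto)
    ultimately have "a \<in> \<beta> S \<longleftrightarrow> i \<in> S" if "S \<subseteq> ?I" for S using that by simp
    thus ?thesis by blast
  qed
  hence "\<forall>i. \<exists>a. \<forall>S\<subseteq>?I. a \<in> \<beta> S \<longleftrightarrow> i \<in> S" ..
  from choice[OF this] obtain a where "\<forall>i. \<forall>S\<subseteq>?I. a i \<in> \<beta> S \<longleftrightarrow> i \<in> S" ..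
  hence a: "a i \<in> \<beta> S \<longleftrightarrow> i \<in> S" if "S \<subseteq> ?I" for i S using that by simp
  have inja: "inj_on a ?I"
  proof (rule inj_onI)
    fix i k assume ik: "i \<in> ?I" "k \<in> ?I" "a i = a k"
    hence "{i} \<subseteq> ?I" by blast
    hence "a i \<in> \<beta> {i}" using a by blast
    hence "a k \<in> \<beta> {i}" unfolding ik(3) .
    hence "k \<in> {i}" using a[OF \<open>{i} \<subseteq> ?I\<close>] by blast
    thus "i = k" by simp
  qed
  have "shatters C (a ` ?I)"
    unfolding shatters_def
  proof (intro allI impI)
    fix D assume D: "D \<subseteq> a ` ?I"
    let ?S = "{i \<in> ?I. a i \<in> D}"
    have "a i \<in> \<beta> ?S \<longleftrightarrow> a i \<in> D" if "i \<in> ?I" for i using a[of ?S i] that by blast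
    hence "\<beta> ?S \<inter> a ` ?I = D" using D by blast
    moreover have "\<beta> ?S \<in> C" using im\<beta>[of ?S] \<open>B' \<subseteq> C\<close> by blast
    ultimately show "\<exists>S\<in>C. S \<inter> a ` ?I = D" by blast
  qed
  hence "card (a ` ?I) \<le> d" using vc unfolding vc_le_def by (meson finite_imageI finite_lessThan)
  thus False using card_image[OF inja] by simp
qed

lemma vc_dim_lessI:
  assumes "0 < q" "\<And>B. finite B \<Longrightarrow> shatters \<F> B \<Longrightarrow> card B < q"
  shows "vc_dim \<F> < enat q"
proof -
  have "vc_dim \<F> \<le> enat (q - 1)"
    unfolding vc_dim_def by (rule Sup_least) (use assms in \<open>auto dest!: assms(2)\<close>)
  also have "\<dots> < enat q" using assms(1) by simp
  finally show ?thesis .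
qed

lemma vc_dim_leD:
  assumes "vc_dim \<F> \<le> enat d" "finite B" "shatters \<F> B"
  shows "card B \<le> d"
proof -
  have "enat (card B) \<le> vc_dim \<F>"
    unfolding vc_dim_def by (rule Sup_upper) (use assms in auto)
  thus ?thesis using assms(1) by (metis enat_ord_simps(1) order_trans)
qed

text \<open>The points are first reduced to one representative for each set of members of \<open>F\<close> which
  contain a common point, and then numbered.\<close>

lemma pq_transversal:
  fixes F :: "'a set set"
  assumes pq: "pq_function N" and "q \<le> p" "0 < q" "finite F" "{} \<notin> F"
    and dual: "\<And>B. finite B \<Longrightarrow> shatters (range (\<lambda>a. {s \<in> F. a \<in> s})) B \<Longrightarrow> card B < q"
    and meet: "\<And>S. S \<subseteq> F \<Longrightarrow> p \<le> card S \<Longrightarrow> \<exists>a. q \<le> card {s \<in> S. a \<in> s}"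
  shows "\<exists>X. finite X \<and> card X \<le> N p q \<and> (\<forall>s\<in>F. X \<inter> s \<noteq> {})"
proof -
  define tr where "tr = (\<lambda>a. {s \<in> F. a \<in> s})"
  define r where "r = (\<lambda>a. inv tr (tr a))"
  have tr_r: "tr (r a) = tr a" for a unfolding r_def by (simp add: f_inv_into_f)
  hence r_iff: "r a \<in> s \<longleftrightarrow> a \<in> s" if "s \<in> F" for a s
    using that unfolding tr_def by blast
  define X where "X = range r"
  have "range tr \<subseteq> Pow F" by (auto simp: tr_def)
  hence "finite (range tr)" using \<open>finite F\<close> finite_subset by blast
  moreover have "X = inv tr ` range tr" by (auto simp: X_def r_def)
  ultimately have "finite X" by simp
  then obtain f :: "'a \<Rightarrow> nat" where f: "inj_on f X"
    using finite_imp_inj_to_nat_seg[OF \<open>finite X\<close>] by (elim exE conjE)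
  define g where "g = (\<lambda>s. f ` (s \<inter> X))"
  have g_iff: "f x \<in> g s \<longleftrightarrow> x \<in> s" if "x \<in> X" for x s
    using f that by (auto simp: g_def inj_on_def)
  have rX: "r a \<in> X" for a by (simp add: X_def)
  \<comment> \<open>Passing to representatives must not merge members, since \<open>p\<close> and
    \<open>q\<close> count them.\<close>
  have inj_g: "inj_on g F"
  proof (rule inj_onI)
    fix s s' assume *: "s \<in> F" "s' \<in> F" "g s = g s'"
    have "a \<in> s \<longleftrightarrow> a \<in> s'" for a
      using g_iff[OF rX[of a], of s] g_iff[OF rX[of a], of s'] r_iff * by simp
    thus "s = s'" by blast
  qed
  have "vc_dim ((\<lambda>u. {t \<in> g ` F. u \<in> t}) ` (f ` X)) < enat q"
  proof (rule vc_dim_lessI[OF \<open>0 < q\<close>])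
    fix B assume B: "finite B" "shatters ((\<lambda>u. {t \<in> g ` F. u \<in> t}) ` (f ` X)) B"
    have "B \<subseteq> g ` F"
      using shatters_superset[OF B(2)] by auto
    then obtain B' where B': "B' \<subseteq> F" "B = g ` B'" unfolding subset_image_iff by (elim exE conjE)
    have injB: "inj_on g B'" using inj_g B'(1) by (rule inj_on_subset)
    have "shatters (range (\<lambda>a. {s \<in> F. a \<in> s})) B'"
      unfolding shatters_def
    proof (intro allI impI)
      fix D assume D: "D \<subseteq> B'"
      hence "g ` D \<subseteq> B" using B' by blast
      then obtain T where "T \<in> (\<lambda>u. {t \<in> g ` F. u \<in> t}) ` (f ` X)" "T \<inter> B = g ` D"
        using B(2) unfolding shatters_def by meson
      then obtain x where x: "x \<in> X" "{t \<in> g ` F. f x \<in> t} \<inter> B = g ` D" by auto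
      have "s \<in> D \<longleftrightarrow> x \<in> s" if "s \<in> B'" for s
      proof -
        have "s \<in> D \<longleftrightarrow> g s \<in> g ` D" using inj_on_image_mem_iff[OF injB that D] by simp
        also have "\<dots> \<longleftrightarrow> f x \<in> g s"
          unfolding x(2)[symmetric] B'(2) using that B'(1) by auto
        finally show ?thesis using g_iff[OF x(1)] by simp
      qed
      hence "{s \<in> F. x \<in> s} \<inter> B' = D" using D B'(1) by blast
      thus "\<exists>S\<in>range (\<lambda>a. {s \<in> F. a \<in> s}). S \<inter> B' = D" by blast
    qed
    moreover have "finite B'" using B'(1) \<open>finite F\<close> finite_subset by blast
    ultimately have "card B' < q" by (rule dual[rotated])
    thus "card B < q" using card_image[OF injB] B'(2) by simp
  qed
  moreover have "\<exists>S0\<subseteq>S. card S0 \<ge> q \<and> f ` X \<inter> \<Inter>S0 \<noteq> {}" if S: "S \<subseteq> g ` F" "card S \<ge> p" for S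
  proof -
    obtain S' where S': "S' \<subseteq> F" "S = g ` S'" using S(1) unfolding subset_image_iff by (elim exE conjE)
    have injS: "inj_on g S'" using inj_g S'(1) by (rule inj_on_subset)
    obtain a where a: "q \<le> card {s \<in> S'. a \<in> s}"
      using meet[OF S'(1)] S(2) S'(2) card_image[OF injS] by auto
    have "card (g ` {s \<in> S'. a \<in> s}) = card {s \<in> S'. a \<in> s}"
      by (rule card_image) (rule inj_on_subset[OF injS], auto)
    moreover have "f (r a) \<in> g s" if "s \<in> S'" "a \<in> s" for s
      using g_iff[OF rX] r_iff that S'(1) by blast
    hence "f (r a) \<in> f ` X \<inter> \<Inter>(g ` {s \<in> S'. a \<in> s})" using rX by auto
    ultimately show ?thesis using a S'(2)
      by (intro exI[of _ "g ` {s \<in> S'. a \<in> s}"]) auto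
  qed
  moreover have "{} \<notin> g ` F"
  proof
    assume "{} \<in> g ` F"
    then obtain s where s: "s \<in> F" "g s = {}" by auto
    hence "s \<noteq> {}" using \<open>{} \<notin> F\<close> by metis
    then obtain a where "a \<in> s" by blast
    thus False using g_iff[OF rX, of a s] r_iff[OF s(1)] s(2) by simp
  qed
  moreover have "finite (f ` X)" "g ` F \<subseteq> Pow (f ` X)"
    using \<open>finite X\<close> by (auto simp: g_def)
  ultimately obtain X0 where X0: "X0 \<subseteq> f ` X" "card X0 \<le> N p q" "\<forall>t\<in>g ` F. X0 \<inter> t \<noteq> {}"
    using pq[unfolded pq_function_def, rule_format, OF \<open>q \<le> p\<close>, of "f ` X" "g ` F"] by blast
  obtain X1 where X1: "X1 \<subseteq> X" "X0 = f ` X1" using X0(1) unfolding subset_image_iff by (elim exE conjE)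
  have "card X1 = card X0" using X1 f card_image inj_on_subset by metis
  moreover have "X1 \<inter> s \<noteq> {}" if "s \<in> F" for s
  proof -
    obtain x where "x \<in> X1" "f x \<in> g s" using X0(3) X1(2) \<open>s \<in> F\<close> by blast
    thus ?thesis using g_iff X1(1) by blast
  qed
  moreover have "finite X1" using X1(1) \<open>finite X\<close> finite_subset by blast
  ultimately show ?thesis using X0(2) by auto
qed

text \<open>For an infinite family a transversal exists only in a compactification, where points are
  ultrafilters.\<close>

lemma pq_ultrafilters:
  fixes F :: "'a set set"
  assumes pq: "pq_function N" and "q \<le> p" "0 < q" "{} \<notin> F"
    and dual: "\<And>F0 B. F0 \<subseteq> F \<Longrightarrow> finite B \<Longrightarrow> shatters (range (\<lambda>a. {s \<in> F0. a \<in> s})) B \<Longrightarrow> card B < q"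
    and meet: "\<And>S. S \<subseteq> F \<Longrightarrow> finite S \<Longrightarrow> p \<le> card S \<Longrightarrow> \<exists>a. q \<le> card {s \<in> S. a \<in> s}"
  shows "\<exists>u. (\<forall>j<N p q. ultra (u j :: 'a filter)) \<and>
    (\<forall>s\<in>F. \<exists>j<N p q. eventually (\<lambda>a. a \<in> s) (u j))"
proof -
  \<comment> \<open>Transversals are coded as sequences of which the first \<open>N p q\<close>
    entries count. The coordinates of an ultrafilter on these sequences are the desired ultrafilters
    on points.\<close>
  let ?H = "\<lambda>s. {h :: nat \<Rightarrow> 'a. \<exists>j<N p q. h j \<in> s}"
  have "(\<Inter>s\<in>F0. ?H s) \<noteq> {}" if F0: "finite F0" "F0 \<subseteq> F" for F0
  proof -
    have "\<exists>X. finite X \<and> card X \<le> N p q \<and> (\<forall>s\<in>F0. X \<inter> s \<noteq> {})"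
    proof (rule pq_transversal[OF pq assms(2,3) F0(1)])
      show "{} \<notin> F0" using assms(4) F0(2) by blast
      show "card B < q" if "finite B" "shatters (range (\<lambda>a. {s \<in> F0. a \<in> s})) B" for B
        using dual[OF F0(2)] that .
      show "\<exists>a. q \<le> card {s \<in> S. a \<in> s}" if "S \<subseteq> F0" "p \<le> card S" for S
        by (rule meet) (use that F0 finite_subset in auto)
    qed
    then obtain X where X: "finite X" "card X \<le> N p q" "\<forall>s\<in>F0. X \<inter> s \<noteq> {}" by blast
    obtain h where h: "bij_betw h {0..<card X} X" using ex_bij_betw_nat_finite[OF X(1)] by blast
    have "\<exists>j<N p q. h j \<in> s" if "s \<in> F0" for s
    proof -
      have "X \<inter> s \<noteq> {}" using X(3) that by (rule bspec)
      then obtain x where x: "x \<in> X" "x \<in> s" by auto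
      have "h ` {0..<card X} = X" using h by (rule bij_betw_imp_surj_on)
      with x(1) have "x \<in> h ` {0..<card X}" by simp
      then obtain j where "j < card X" "x = h j" by auto
      thus ?thesis using X(2) x(2) by (intro exI[of _ j]) simp
    qed
    hence "h \<in> (\<Inter>s\<in>F0. ?H s)" by blast
    thus ?thesis by blast
  qed
  then obtain U where U: "ultra U" "\<And>s. s \<in> F \<Longrightarrow> eventually (\<lambda>h. h \<in> ?H s) U"
    using ultra_fip[of F ?H] by blast
  have "\<exists>j<N p q. eventually (\<lambda>a. a \<in> s) (filtermap (\<lambda>h. h j) U)" if "s \<in> F" for s
    using ultra_Bex_finite[OF U(1), of "{..<N p q}" "\<lambda>j h. h j \<in> s"] U(2)[OF that]
    by (auto simp: eventually_filtermap Bex_def)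
  thus ?thesis using ultra_filtermap[OF U(1)] by (intro exI[of _ "\<lambda>j. filtermap (\<lambda>h. h j) U"]) auto
qed

text \<open>This rules out the exceptional branch \<open>n = 1\<close> of \<open>k_sd\<close>. Two
  disjoint singletons need two points, and with fewer than \<open>p\<close> members they satisfy the
  intersection hypothesis vacuously.\<close>

lemma pq_function_ge_2:
  assumes "pq_function N" "2 \<le> q" "q \<le> p" "3 \<le> p"
  shows "2 \<le> N p q"
proof -
  let ?X = "{0, 1} :: nat set" and ?F = "{{0}, {1}} :: nat set set"
  have "card B < q" if B: "finite B" "shatters ((\<lambda>u. {s \<in> ?F. u \<in> s}) ` ?X) B" for B
  proof -
    obtain S where "S \<in> (\<lambda>u. {s \<in> ?F. u \<in> s}) ` ?X" "B \<subseteq> S"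
      using shatters_superset[OF B(2)] by (elim bexE)
    hence "B \<subseteq> {{0}} \<or> B \<subseteq> {{1}}" by auto
    hence "card B \<le> 1" using card_mono[of "{{0::nat}}" B] card_mono[of "{{1::nat}}" B] by auto
    thus ?thesis using assms(2) by simp
  qed
  hence "vc_dim ((\<lambda>u. {s \<in> ?F. u \<in> s}) ` ?X) < enat q"
    using assms(2) by (intro vc_dim_lessI) auto
  moreover have "\<not> p \<le> card S" if "S \<subseteq> ?F" for S
    using card_mono[of ?F S] that assms(4) by auto
  moreover have "finite ?X" "?F \<subseteq> Pow ?X" "{} \<notin> ?F" by auto
  ultimately obtain X0 where X0: "X0 \<subseteq> ?X" "card X0 \<le> N p q" "\<forall>s\<in>?F. X0 \<inter> s \<noteq> {}"
    using assms(1)[unfolded pq_function_def, rule_format, OF \<open>q \<le> p\<close>, of ?X ?F] by blast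
  have "X0 = ?X" using X0(1,3) by auto
  thus ?thesis using X0(2) by simp
qed

section \<open>Estimates\<close>

lemma binom_le_upper:
  assumes "0 < s"
  shows "binom_le s k \<le> Suc k * s ^ k"
proof -
  have "s choose i \<le> s ^ k" if "i \<le> k" for i
  proof (cases "i \<le> s")
    case True
    hence "s choose i \<le> s ^ i" by (rule binomial_le_pow)
    also have "\<dots> \<le> s ^ k" using assms that by (simp add: power_increasing)
    finally show ?thesis .
  qed (simp add: binomial_eq_0)
  thus ?thesis using sum_bounded_above[of "{..k}" "\<lambda>i. s choose i" "s ^ k"]
    unfolding binom_le_def by simp
qed

text \<open>Without finiteness \<open>Max\<close> would be meaningless. The power of
  \<open>binom_le s k\<close> grows like a polynomial of degree \<open>k * n\<close> in
  \<open>s\<close>, whereas \<open>2 ^ s\<close> dominates a binomial coefficient of degree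
  \<open>k * n + 1\<close>.\<close>

lemma finite_B_vc: "finite {s. binom_le s k ^ n \<ge> 2 ^ s}"
proof -
  let ?m = "Suc (k * n)"
  have "s \<le> max ?m (?m ^ ?m * Suc k ^ n)" if "2 ^ s \<le> binom_le s k ^ n" for s
  proof (cases "s \<le> ?m")
    case False
    hence s: "0 < s" "?m \<le> s" by auto
    have "(real s / real ?m) ^ ?m \<le> real (s choose ?m)"
      using binomial_ge_n_over_k_pow_k[OF s(2), where 'a = real] by simp
    also have "\<dots> \<le> 2 ^ s" using binomial_le_pow2[of s ?m] by (metis of_nat_le_iff of_nat_numeral of_nat_power)
    also have "\<dots> \<le> real (binom_le s k ^ n)" using that by (metis of_nat_le_iff of_nat_numeral of_nat_power)
    also have "\<dots> \<le> real ((Suc k * s ^ k) ^ n)" using binom_le_upper[OF s(1), of k]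
      by (simp only: of_nat_le_iff power_mono)
    finally have "real s ^ ?m \<le> real ?m ^ ?m * real ((Suc k * s ^ k) ^ n)"
      by (simp add: power_divide divide_le_eq mult.commute del: power_Suc of_nat_Suc)
    hence "s ^ ?m \<le> ?m ^ ?m * (Suc k * s ^ k) ^ n"
      by (metis of_nat_le_iff of_nat_mult of_nat_power)
    also have "\<dots> = (?m ^ ?m * Suc k ^ n) * s ^ (k * n)"
      by (simp only: power_mult_distrib power_mult mult.assoc)
    finally have "s * s ^ (k * n) \<le> (?m ^ ?m * Suc k ^ n) * s ^ (k * n)"
      by (simp only: power_Suc)
    hence "s \<le> ?m ^ ?m * Suc k ^ n" using s(1) by (simp only: mult_le_cancel2) simp
    thus ?thesis by simp
  qed simp
  hence "{s. binom_le s k ^ n \<ge> 2 ^ s} \<subseteq> {..max ?m (?m ^ ?m * Suc k ^ n)}" by blast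
  thus ?thesis by (rule finite_subset) (rule finite_atMost)
qed

lemma binom_le_lower: "k \<le> s \<Longrightarrow> 2 ^ k \<le> binom_le s k"
proof -
  assume "k \<le> s"
  hence "(k choose i) \<le> (s choose i)" for i by (rule binomial_right_mono)
  hence "(\<Sum>i\<le>k. k choose i) \<le> binom_le s k" unfolding binom_le_def by (rule sum_mono)
  thus ?thesis by (simp add: choose_row_sum)
qed

lemma B_vc_ge: "0 < n \<Longrightarrow> n * k \<le> B_vc n k"
proof -
  assume "0 < n"
  hence "2 ^ k \<le> binom_le (n * k) k" by (intro binom_le_lower) simp
  hence "(2 ^ k) ^ n \<le> binom_le (n * k) k ^ n" by (rule power_mono) simp
  hence "2 ^ (n * k) \<le> binom_le (n * k) k ^ n" by (simp add: power_mult[symmetric] mult.commute)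
  thus ?thesis unfolding B_vc_def using finite_B_vc by (intro Max_ge) auto
qed

lemma K_dens_le: "K_dens d \<le> d * d * 2 ^ d"
proof (induction d)
  case (Suc d)
  have "K_dens (Suc d) \<le> d * d * 2 ^ d + 2 ^ Suc d * Suc d" using Suc by simp
  also have "\<dots> \<le> Suc d * Suc d * 2 ^ Suc d" by (simp add: algebra_simps)
  finally show ?case .
qed simp

text \<open>The argument \<open>e\<close> given to \<open>k_comp\<close> is exponential in a number
  that is at least \<open>2 * (N * d)\<close>. It therefore dominates both \<open>K_dens d\<close>
  and \<open>2 * d + N * d\<close>, and the summand \<open>2 * e + 2\<close> covers the whole
  bound.\<close>

lemma k_sd_ge:
  assumes "2 \<le> N"
  shows "K_dens d + 2 * (N * d) + (N * d + 1) * N \<le> k_sd N d"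
proof -
  define e :: nat where "e = 2 ^ (B_vc N (2 ^ (d + 1)) + 1)"
  have dd: "d < 2 ^ d" by (rule less_exp)
  have "N * 2 ^ (d + 1) \<le> B_vc N (2 ^ (d + 1))" using assms by (intro B_vc_ge) simp
  moreover have "2 * (N * d) \<le> N * 2 ^ (d + 1)" using dd by simp
  ultimately have B: "2 * (N * d) \<le> B_vc N (2 ^ (d + 1))" by linarith
  have "2 * (N * d) \<le> e"
  proof -
    have "2 * (N * d) \<le> B_vc N (2 ^ (d + 1)) + 1" using B by linarith
    also have "\<dots> \<le> e" unfolding e_def by (rule less_imp_le) (rule less_exp)
    finally show ?thesis .
  qed
  moreover have "2 * d \<le> N * d" using assms by simp
  ultimately have e1: "2 * d + N * d \<le> e" by linarith
  have "K_dens d \<le> d * d * 2 ^ d" by (rule K_dens_le)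
  also have "\<dots> \<le> 2 ^ d * 2 ^ d * 2 ^ d" using dd by (intro mult_le_mono) auto
  also have "\<dots> = 2 ^ (3 * d)" by (simp add: power_add[symmetric])
  also have "\<dots> \<le> e"
    unfolding e_def
  proof (rule power_increasing)
    have "2 * (2 * d) \<le> 2 * (N * d)" using assms by simp
    thus "3 * d \<le> B_vc N (2 ^ (d + 1)) + 1" using B by linarith
  qed simp
  finally have e2: "K_dens d \<le> e" .
  have "K_dens d + 2 * (N * d) + (N * d + 1) * N = K_dens d + N * (2 * d + N * d) + N"
    by (simp add: algebra_simps)
  also have "\<dots> \<le> N * e + N * e + N"
  proof -
    have "1 * K_dens d \<le> N * e" using e2 assms by (intro mult_le_mono) auto
    moreover have "N * (2 * d + N * d) \<le> N * e" using e1 by (intro mult_le_mono) auto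
    ultimately show ?thesis by linarith
  qed
  also have "\<dots> \<le> N * (k_comp e + 2 * e + 2)" by (simp add: algebra_simps)
  also have "\<dots> = k_sd N d" using assms by (simp add: k_sd_def e_def)
  finally show ?thesis .
qed

section \<open>Rounded averages of compressible sets\<close>

theorem rounded_average_sets:
  fixes \<alpha> :: real and C :: "'a set set"
  assumes pq: "pq_function N" and \<alpha>: "1 / 2 \<le> \<alpha>" "\<alpha> < 1"
    and n: "(1 - \<alpha>) * real n > 2 ^ (d + 1) - 1"
    and k: "k = k_sd (N n (2 ^ (d + 1))) d"
    and C: "closed_class C" "vc_le C d" "{} \<in> C"
  shows "\<exists>P. (\<forall>i<n. P i \<in> C \<and> compr C k (P i)) \<and>
    (\<forall>a. real (card {i. i < n \<and> a \<notin> P i}) > \<alpha> * real n)"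
proof -
  let ?q = "2 ^ (d + 1) :: nat"
  have q2: "2 \<le> ?q" by simp
  have "(1 - \<alpha>) * real n \<le> 1 / 2 * real n" using \<alpha> by (intro mult_right_mono) auto
  with n have "2 ^ (d + 1) - 1 < 1 / 2 * real n" by (rule less_le_trans)
  hence "real (2 * ?q) < real (n + 2)" by simp
  hence nq: "2 * ?q < n + 2" by (simp only: of_nat_less_iff)
  have n3: "3 \<le> n" and qn: "?q \<le> n" using nq q2 by linarith+
  let ?K = "{q \<in> C. compr C k q}"
  show ?thesis
  \<comment> \<open>If the empty set is compressible, its constant repetition works; otherwise the
    members are nonempty, as the (p,q)-theorem demands.\<close>
  proof (cases "{} \<in> ?K")
    case True
    thus ?thesis using \<alpha> n3 by (intro exI[of _ "\<lambda>_. {}"]) auto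
  next
    case False
    show ?thesis
    proof (cases "\<exists>S\<subseteq>?K. finite S \<and> card S = n \<and> (\<forall>a. card {s \<in> S. a \<in> s} < ?q)")
      case True
      then obtain S where S: "S \<subseteq> ?K" "finite S" "card S = n" "\<And>a. card {s \<in> S. a \<in> s} < ?q"
        by blast
      obtain P where P: "bij_betw P {0..<n} S" using ex_bij_betw_nat_finite[OF S(2)] S(3) by blast
      \<comment> \<open>At most \<open>?q - 1\<close> of the \<open>n\<close> sets contain
        \<open>a\<close>, which is less than \<open>(1 - \<alpha>) * real n\<close> by the choice of
        \<open>n\<close>.\<close>
      have "real (card {i. i < n \<and> a \<notin> P i}) > \<alpha> * real n" for a
      proof -
        have "P ` {i. i < n \<and> a \<in> P i} = {s \<in> S. a \<in> s}"
          using P by (auto simp: bij_betw_def)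
        moreover have "inj_on P {i. i < n \<and> a \<in> P i}"
          by (rule inj_on_subset[of P "{0..<n}"]) (use P in \<open>auto simp: bij_betw_def\<close>)
        ultimately have "card {i. i < n \<and> a \<in> P i} < ?q" using S(4)[of a] card_image by metis
        hence "real (card {i. i < n \<and> a \<in> P i}) \<le> real (?q - 1)" by (intro of_nat_mono) simp
        hence le: "real (card {i. i < n \<and> a \<in> P i}) \<le> 2 ^ (d + 1) - 1" by (simp add: of_nat_diff)
        have "card ({i. i < n \<and> a \<in> P i} \<union> {i. i < n \<and> a \<notin> P i}) =
            card {i. i < n \<and> a \<in> P i} + card {i. i < n \<and> a \<notin> P i}"
          by (rule card_Un_disjoint) auto
        moreover have "{i. i < n \<and> a \<in> P i} \<union> {i. i < n \<and> a \<notin> P i} = {..<n}" by auto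
        ultimately have "real n = real (card {i. i < n \<and> a \<in> P i}) + real (card {i. i < n \<and> a \<notin> P i})"
          by simp
        thus ?thesis using le n by (simp add: algebra_simps)
      qed
      moreover have "P i \<in> S" if "i < n" for i using bij_betwE[OF P] that by simp
      hence "\<forall>i<n. P i \<in> C \<and> compr C k (P i)" using S(1) by auto
      ultimately show ?thesis by (intro exI[of _ P]) simp
    next
      case nex: False
      \<comment> \<open>Now any \<open>n\<close> compressible members include \<open>?q\<close> with
        a common point: the (p,q)-property with \<open>p = n\<close>.\<close>
      have "\<exists>u. (\<forall>j<N n ?q. ultra (u j :: 'a filter)) \<and>
        (\<forall>s\<in>?K. \<exists>j<N n ?q. eventually (\<lambda>a. a \<in> s) (u j))"
      proof (rule pq_ultrafilters[OF pq qn _ False])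
        show "0 < ?q" by simp
        show "card B < ?q" if "F0 \<subseteq> ?K" "finite B" "shatters (range (\<lambda>a. {s \<in> F0. a \<in> s})) B"
          for F0 B :: "'a set set"
          using dual_vc[OF C(2) _ that(2,3)] that(1) by auto
        show "\<exists>a. ?q \<le> card {s \<in> S. a \<in> s}" if S: "S \<subseteq> ?K" "finite S" "n \<le> card S" for S
        proof -
          obtain S' where S': "S' \<subseteq> S" "card S' = n"
            using obtain_subset_with_card_n[OF S(3)] by metis
          have "finite S'" "S' \<subseteq> ?K" using S' S finite_subset by auto
          have "\<not> (\<forall>a. card {s \<in> S'. a \<in> s} < ?q)"
          proof
            assume "\<forall>a. card {s \<in> S'. a \<in> s} < ?q"
            with S'(2) \<open>finite S'\<close> \<open>S' \<subseteq> ?K\<close> show False using nex by (elim notE) (intro exI conjI)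
          qed
          then obtain a where "\<not> card {s \<in> S'. a \<in> s} < ?q" unfolding not_all by (elim exE)
          moreover have "card {s \<in> S'. a \<in> s} \<le> card {s \<in> S. a \<in> s}"
            by (rule card_mono) (use S S' in auto)
          ultimately have "?q \<le> card {s \<in> S. a \<in> s}" by linarith
          thus ?thesis by blast
        qed
      qed
      then obtain u where u: "\<And>j. j < N n ?q \<Longrightarrow> ultra (u j :: 'a filter)"
        "\<And>s. s \<in> ?K \<Longrightarrow> \<exists>j<N n ?q. eventually (\<lambda>a. a \<in> s) (u j)" by blast
      interpret ultra_family u "N n ?q" by unfold_locales (rule u(1))
      obtain q where q: "q \<in> C"
        "compr C (K_dens d + 2 * (N n ?q * d) + (N n ?q * d + 1) * N n ?q) q"
        "\<forall>j<N n ?q. eventually (\<lambda>a. a \<notin> q) (u j)"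
        using strong_density[OF C] by blast
      have "compr C k q"
        unfolding k by (rule compr_mono[OF q(2)]) (rule k_sd_ge, rule pq_function_ge_2[OF pq q2 qn n3])
      then obtain j where j: "j < N n ?q" "eventually (\<lambda>a. a \<in> q) (u j)" using u(2) q(1) by blast
      hence "\<not> eventually (\<lambda>a. a \<notin> q) (u j)" using ultra_not_eventually[OF u(1), of j] by simp
      thus ?thesis using q(3) j(1) by blast
    qed
  qed
qed

section \<open>Instances and saturation\<close>

lemma eval_inst_tm: "eval (with_params M) b (inst_tm x a t) = eval M (override_on b a x) t"
  by (induction t) (auto simp: with_params_def override_on_def o_def intro!: arg_cong[of _ _ "func M _"])

lemma sat_inst: "sat (with_params M) b (inst x a \<psi>) \<longleftrightarrow> sat M (override_on b a x) \<psi>"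
proof (induction \<psi> arbitrary: b x)
  case (Exists v \<psi>)
  have "override_on (b(v := u)) a (x - {v}) = (override_on b a x)(v := u)" for u
    by (auto simp: override_on_def)
  then show ?case by (simp add: Exists.IH del: fun_upd_apply) (simp add: with_params_def del: fun_upd_apply)
qed (simp_all add: eval_inst_tm o_def, simp add: with_params_def)

lemma sat_fm_pow_inst:
  "sat (with_params M) b (fm_pow (inst x a \<psi>) \<epsilon>) \<longleftrightarrow> sat M (override_on b a x) \<psi> = \<epsilon>"
  by (simp add: fm_pow_def sat_inst)

lemma fv_inst_tm: "fv_tm (inst_tm x a t) = fv_tm t - x"
  by (induction t) auto

lemma fv_inst: "fv (inst x a \<psi>) = fv \<psi> - x"
  by (induction \<psi> arbitrary: x) (auto simp: fv_inst_tm)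

lemma wf_inst_tm: "wf_tm L t \<Longrightarrow> a ` x \<subseteq> U \<Longrightarrow> wf_tm (lang_params L U) (inst_tm x a t)"
  by (induction t) (auto simp: lang_params_def)

lemma wf_inst: "wf_fm L \<psi> \<Longrightarrow> a ` x \<subseteq> U \<Longrightarrow> wf_fm (lang_params L U) (inst x a \<psi>)"
proof (induction \<psi> arbitrary: x)
  case (Exists v \<psi>)
  then show ?case by (simp add: image_subset_iff)
qed (auto simp: wf_inst_tm, auto simp: lang_params_def)

lemma fm_pow_inst_formulas:
  assumes "\<psi> \<in> formulas L (x \<union> y)" "a \<in> tuples M x"
  shows "fm_pow (inst x a \<psi>) \<epsilon> \<in> formulas (lang_params L (univ M)) y"
proof -
  have "a ` x \<subseteq> univ M" using assms(2) by (auto simp: tuples_def)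
  thus ?thesis using assms(1) wf_inst[of L \<psi> a x "univ M"]
    by (auto simp: formulas_def fm_pow_def fv_inst)
qed

section \<open>Smallness of parameter sets, and realization of consistent sets\<close>

lemma wf_tm_params:
  "wf_tm (lang_params L U) t \<Longrightarrow> U \<inter> {v. Inr v \<in> set_tm t} \<subseteq> P \<Longrightarrow> wf_tm (lang_params L P) t"
  by (induction t) (auto simp: lang_params_def)

lemma wf_fm_params:
  "wf_fm (lang_params L U) \<psi> \<Longrightarrow> U \<inter> {v. Inr v \<in> set1_fm \<psi>} \<subseteq> P \<Longrightarrow> wf_fm (lang_params L P) \<psi>"
proof (induction \<psi>)
  case (Eq s t)
  then show ?case using wf_tm_params[of L U s P] wf_tm_params[of L U t P] by auto
next
  case (Rel R ts)
  then have "wf_tm (lang_params L P) t" if "t \<in> set ts" for t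
    using that wf_tm_params[of L U t P] by auto
  then show ?case using Rel by (auto simp: lang_params_def)
qed auto

lemma finite_set_tm: "finite (set_tm t)"
  by (induction t) auto

lemma finite_set1_fm: "finite (set1_fm \<psi>)"
  by (induction \<psi>) (auto simp: finite_set_tm)

lemma finite_card_less_infinite: "finite A \<Longrightarrow> infinite B \<Longrightarrow> |A| <o |B|"
  using finite_ordLess_infinite[OF card_of_Well_order card_of_Well_order] by (simp add: Field_card_of)

lemma small_params:
  assumes inf: "infinite (univ M)" and small: "small M \<Sigma>" and fin: "\<And>\<psi>. \<psi> \<in> \<Sigma> \<Longrightarrow> finite (P \<psi>)"
  shows "small M (\<Union>\<psi>\<in>\<Sigma>. P \<psi>)"
proof (cases "finite \<Sigma>")
  case True
  hence "finite (\<Union>\<psi>\<in>\<Sigma>. P \<psi>)" using fin by blast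
  thus ?thesis unfolding small_def using inf by (rule finite_card_less_infinite)
next
  case False
  have "|P \<psi>| \<le>o |\<Sigma>|" if "\<psi> \<in> \<Sigma>" for \<psi>
    using finite_card_less_infinite[OF fin[OF that] False] by (rule ordLess_imp_ordLeq)
  hence "|\<Union>\<psi>\<in>\<Sigma>. P \<psi>| \<le>o |\<Sigma>|"
    using card_of_UNION_ordLeq_infinite[OF False ordLeq_refl[OF card_of_Card_order]] by blast
  thus ?thesis using small unfolding small_def by (rule ordLeq_ordLess_trans)
qed

lemma small_Un_finite:
  assumes "infinite (univ M)" "small M \<pi>" "finite \<Sigma>"
  shows "small M (\<pi> \<union> \<Sigma>)"
proof -
  have "|\<Sigma>| <o |univ M|" using assms(3,1) by (rule finite_card_less_infinite)
  thus ?thesis using assms(1,2) unfolding small_def by (intro card_of_Un_ordLess_infinite)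
qed

lemma consistent_mono: "consistent M y \<Sigma> \<Longrightarrow> \<Theta> \<subseteq> \<Sigma> \<Longrightarrow> consistent M y \<Theta>"
  unfolding consistent_def by (meson order_trans)

text \<open>Saturation asks for a small parameter set, while the formulas are over all of
  \<open>univ M\<close>. In the infinite case a small set of formulas mentions only few
  parameters.\<close>

lemma consistent_realized:
  fixes M :: "('f, 'r, 'u) fo_structure"
  assumes sat: "saturated L M" and "finite y"
    and form: "\<pi> \<union> \<Sigma> \<subseteq> formulas (lang_params L (univ M)) y"
    and cons: "consistent M y (\<pi> \<union> \<Sigma>)" and "small M \<pi>" "finite \<Sigma>"
  shows "\<exists>b\<in>tuples M y. realizes M b (\<pi> \<union> \<Sigma>)"
\<comment> \<open>In a finite model the formulas may name every element, which is not a small set;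
  instead one refuting formula per tuple yields a finite inconsistent part.\<close>
proof (cases "finite (univ M)")
  case True
  hence fin: "finite (tuples M y)" unfolding tuples_def using \<open>finite y\<close> by (intro finite_PiE)
  show ?thesis
  proof (rule ccontr)
    assume "\<not> ?thesis"
    hence "\<forall>b\<in>tuples M y. \<exists>\<psi>. \<psi> \<in> \<pi> \<union> \<Sigma> \<and> \<not> sat (with_params M) b \<psi>"
      unfolding realizes_def by blast
    from bchoice[OF this] obtain f
      where f: "\<forall>b\<in>tuples M y. f b \<in> \<pi> \<union> \<Sigma> \<and> \<not> sat (with_params M) b (f b)" ..
    hence "f ` tuples M y \<subseteq> \<pi> \<union> \<Sigma>" by blast
    then obtain b where "b \<in> tuples M y" "realizes M b (f ` tuples M y)"
      using cons fin unfolding consistent_def by (meson finite_imageI)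
    thus False using f unfolding realizes_def by blast
  qed
next
  case inf: False
  let ?P = "\<lambda>\<psi>. univ M \<inter> {v. Inr v \<in> set1_fm \<psi>}"
  let ?A = "\<Union>\<psi>\<in>\<pi> \<union> \<Sigma>. ?P \<psi>"
  have "finite (?P \<psi>)" for \<psi> :: "('f + 'u, 'r) fm"
  proof -
    have "finite (Inr -` set1_fm \<psi>)" by (rule finite_vimageI[OF finite_set1_fm]) simp
    thus ?thesis by (simp add: vimage_def)
  qed
  hence small: "small M ?A"
    by (intro small_params[OF inf] small_Un_finite[OF inf \<open>small M \<pi>\<close> \<open>finite \<Sigma>\<close>])
  have "\<pi> \<union> \<Sigma> \<subseteq> formulas (lang_params L ?A) y"
  proof
    fix \<psi> assume \<psi>: "\<psi> \<in> \<pi> \<union> \<Sigma>"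
    hence "wf_fm (lang_params L (univ M)) \<psi>" "fv \<psi> \<subseteq> y" using form by (auto simp: formulas_def)
    moreover have "?P \<psi> \<subseteq> ?A" using \<psi> by (rule UN_upper)
    ultimately show "\<psi> \<in> formulas (lang_params L ?A) y"
      unfolding formulas_def using wf_fm_params[of L "univ M" \<psi> ?A] by simp
  qed
  hence "partial_type L M ?A y (\<pi> \<union> \<Sigma>)" using cons by (simp add: partial_type_def)
  moreover have "?A \<subseteq> univ M" by (rule UN_least) (rule inf_le1)
  ultimately show ?thesis
    using sat[unfolded saturated_def, rule_format, OF _ small \<open>finite y\<close>] by simp
qed

section \<open>Types as sets of disagreement with a fixed type\<close>

text \<open>The topological closure, which makes compactness available without changing traces on
  finite sets.\<close>

definition closure_class :: "'a set set \<Rightarrow> 'a set set" where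
  "closure_class C = {c. \<forall>B. finite B \<longrightarrow> (\<exists>c'\<in>C. c' \<inter> B = c \<inter> B)}"

lemma closure_classD: "c \<in> closure_class C \<Longrightarrow> finite B \<Longrightarrow> \<exists>c'\<in>C. c' \<inter> B = c \<inter> B"
  by (simp add: closure_class_def)

lemma closed_closure_class: "closed_class (closure_class C)"
  unfolding closed_class_def closure_class_def
proof (intro allI impI CollectI)
  fix c and B :: "'a set"
  assume "\<forall>B. finite B \<longrightarrow> (\<exists>c'\<in>{c. \<forall>B. finite B \<longrightarrow> (\<exists>c'\<in>C. c' \<inter> B = c \<inter> B)}. c' \<inter> B = c \<inter> B)"
    and B: "finite B"
  then obtain c' where c': "\<forall>B. finite B \<longrightarrow> (\<exists>c''\<in>C. c'' \<inter> B = c' \<inter> B)" "c' \<inter> B = c \<inter> B" by auto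
  show "\<exists>c'\<in>C. c' \<inter> B = c \<inter> B" using c'(1)[rule_format, OF B] unfolding c'(2) .
qed

lemma closure_class_superset: "C \<subseteq> closure_class C"
  by (auto simp: closure_class_def)

lemma vc_le_closure_class:
  assumes "vc_le C d"
  shows "vc_le (closure_class C) d"
  unfolding vc_le_def
proof (intro allI impI)
  fix B :: "'a set" assume B: "finite B" "shatters (closure_class C) B"
  have "shatters C B"
    unfolding shatters_def
  proof (intro allI impI)
    fix D assume "D \<subseteq> B"
    then obtain S where "S \<in> closure_class C" "S \<inter> B = D" using B(2) unfolding shatters_def by meson
    thus "\<exists>S\<in>C. S \<inter> B = D" using B(1) by (auto simp: closure_class_def)
  qed
  thus "card B \<le> d" using assms B(1) by (simp add: vc_le_def)
qed

locale opp_setting =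
  fixes L :: "('f, 'r) language" and M :: "('f, 'r, 'u) fo_structure" and x y \<phi> \<pi> A p
  assumes sat: "saturated L M" and fin: "finite y"
    and \<phi>: "\<phi> \<in> formulas L (x \<union> y)" and A: "A \<subseteq> tuples M x"
    and \<pi>: "\<pi> \<subseteq> formulas (lang_params L (univ M)) y" "small M \<pi>"
    and p: "p \<in> opp_types M x y \<phi> \<pi> A"
begin

abbreviation holds :: "(nat \<Rightarrow> 'u) \<Rightarrow> (nat \<Rightarrow> 'u) \<Rightarrow> bool" where
  "holds b a \<equiv> sat M (override_on b a x) \<phi>"

abbreviation lit :: "(nat \<Rightarrow> 'u) \<Rightarrow> bool \<Rightarrow> ('f + 'u, 'r) fm" where
  "lit a \<epsilon> \<equiv> fm_pow (inst x a \<phi>) \<epsilon>"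

definition val :: "(nat \<Rightarrow> 'u) \<Rightarrow> bool" where
  "val a \<longleftrightarrow> inst x a \<phi> \<in> p"

definition disagree :: "(nat \<Rightarrow> 'u) \<Rightarrow> (nat \<Rightarrow> 'u) set" where
  "disagree b = {a \<in> A. holds b a \<noteq> val a}"

definition realized :: "(nat \<Rightarrow> 'u) set set" where
  "realized = disagree ` {b \<in> tuples M y. realizes M b \<pi>}"

text \<open>The decoding: membership in \<open>c\<close> flips the truth value given by
  \<open>p\<close>.\<close>

definition type_of :: "(nat \<Rightarrow> 'u) set \<Rightarrow> ('f + 'u, 'r) fm set" where
  "type_of c = {lit a ((a \<in> c) \<noteq> val a) |a. a \<in> A}"

abbreviation "C \<equiv> closure_class realized"

lemma p_props: "p \<subseteq> opp_fms x \<phi> A" "consistent M y (p \<union> \<pi>)" "consistent M y p"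
  "\<And>p'. p \<subseteq> p' \<Longrightarrow> p' \<subseteq> opp_fms x \<phi> A \<Longrightarrow> consistent M y p' \<Longrightarrow> p' = p"
  using p by (auto simp: opp_types_def opp_type_def)

text \<open>If neither literal could be added to \<open>p\<close>, two finite parts of
  \<open>p\<close> would refute them, and a common realization of both parts would give the instance
  no truth value.\<close>

lemma p_contains:
  assumes "a \<in> A"
  shows "lit a True \<in> p \<or> lit a False \<in> p"
proof (rule ccontr)
  assume "\<not> ?thesis"
  hence no: "lit a \<epsilon> \<notin> p" for \<epsilon> by (cases \<epsilon>) auto
  have "\<exists>q\<subseteq>p. finite q \<and> (\<forall>b\<in>tuples M y. realizes M b q \<longrightarrow> holds b a \<noteq> \<epsilon>)" for \<epsilon>
  proof -
    have "\<not> consistent M y (insert (lit a \<epsilon>) p)"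
    proof
      assume "consistent M y (insert (lit a \<epsilon>) p)"
      moreover have "insert (lit a \<epsilon>) p \<subseteq> opp_fms x \<phi> A"
        using p_props(1) assms by (auto simp: opp_fms_def)
      ultimately have "insert (lit a \<epsilon>) p = p" using p_props(4) by blast
      thus False using no by blast
    qed
    then obtain q where q: "q \<subseteq> insert (lit a \<epsilon>) p" "finite q"
      "\<forall>b\<in>tuples M y. \<not> realizes M b q" unfolding consistent_def by blast
    have "holds b a \<noteq> \<epsilon>" if "b \<in> tuples M y" "realizes M b (q - {lit a \<epsilon>})" for b
    proof
      assume "holds b a = \<epsilon>"
      hence "sat (with_params M) b (lit a \<epsilon>)" by (simp add: sat_fm_pow_inst)
      hence "realizes M b q" using that(2) by (auto simp: realizes_def)
      thus False using q(3) that(1) by blast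
    qed
    moreover have "q - {lit a \<epsilon>} \<subseteq> p" "finite (q - {lit a \<epsilon>})" using q by auto
    ultimately show ?thesis by blast
  qed
  then obtain q where q: "\<And>\<epsilon>. q \<epsilon> \<subseteq> p \<and> finite (q \<epsilon>) \<and>
    (\<forall>b\<in>tuples M y. realizes M b (q \<epsilon>) \<longrightarrow> holds b a \<noteq> \<epsilon>)" by metis
  have "q True \<union> q False \<subseteq> p" "finite (q True \<union> q False)" using q by auto
  then obtain b where b: "b \<in> tuples M y" "realizes M b (q True \<union> q False)"
    using p_props(3) unfolding consistent_def by meson
  hence "realizes M b (q True)" "realizes M b (q False)" by (auto simp: realizes_def)
  thus False using q b(1) by blast
qed

lemma not_both:
  assumes "consistent M y q" "lit a \<epsilon> \<in> q" "lit a \<epsilon>' \<in> q"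
  shows "\<epsilon> = \<epsilon>'"
proof -
  have "{lit a \<epsilon>, lit a \<epsilon>'} \<subseteq> q" using assms by blast
  then obtain b where "realizes M b {lit a \<epsilon>, lit a \<epsilon>'}"
    using assms(1) unfolding consistent_def by (meson finite.emptyI finite_insert)
  hence "holds b a = \<epsilon>" "holds b a = \<epsilon>'" by (auto simp: realizes_def sat_fm_pow_inst)
  thus ?thesis by simp
qed

lemma lit_in_p: "a \<in> A \<Longrightarrow> lit a \<epsilon> \<in> p \<longleftrightarrow> \<epsilon> = val a"
proof -
  assume a: "a \<in> A"
  have "lit a True \<in> p \<longleftrightarrow> val a" by (simp add: fm_pow_def val_def)
  hence "lit a (val a) \<in> p" using p_contains[OF a] by (cases "val a") auto
  thus ?thesis using not_both[OF p_props(3)] by blast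
qed

lemma realized_subset: "realized \<subseteq> Pow A"
  by (auto simp: realized_def disagree_def)

lemma C_subset: "c \<in> C \<Longrightarrow> c \<subseteq> A"
proof
  fix a assume "c \<in> C" "a \<in> c"
  then obtain c' where c': "c' \<in> realized" "c' \<inter> {a} = c \<inter> {a}"
    using closure_classD[of c realized "{a}"] by auto
  hence "a \<in> c'" using \<open>a \<in> c\<close> by blast
  thus "a \<in> A" using realized_subset c'(1) by blast
qed

lemma C_realized:
  assumes "c \<in> C" "finite B" "B \<subseteq> A"
  shows "\<exists>b\<in>tuples M y. realizes M b \<pi> \<and> (\<forall>a\<in>B. holds b a = ((a \<in> c) \<noteq> val a))"
proof -
  obtain c' where c': "c' \<in> realized" "c' \<inter> B = c \<inter> B"
    using closure_classD[OF assms(1,2)] by (elim bexE)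
  then obtain b where b: "b \<in> tuples M y" "realizes M b \<pi>" "c' = disagree b"
    by (auto simp: realized_def)
  have "holds b a = ((a \<in> c) \<noteq> val a)" if "a \<in> B" for a
  proof -
    have "a \<in> c \<longleftrightarrow> a \<in> disagree b" using c'(2) that b(3) by blast
    moreover have "a \<in> disagree b \<longleftrightarrow> holds b a \<noteq> val a"
      using that assms(3) by (auto simp: disagree_def)
    ultimately show ?thesis by blast
  qed
  thus ?thesis using b by blast
qed

text \<open>Saturation enters here: a finite part of \<open>p\<close> must be realized together with
  all of \<pi>.\<close>

lemma empty_in_C: "{} \<in> C"
  unfolding closure_class_def
proof (intro CollectI allI impI)
  fix B :: "(nat \<Rightarrow> 'u) set" assume B: "finite B"
  let ?\<Sigma> = "(\<lambda>a. lit a (val a)) ` (A \<inter> B)"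
  have "?\<Sigma> \<subseteq> p" using lit_in_p by auto
  hence "consistent M y (\<pi> \<union> ?\<Sigma>)" using consistent_mono[OF p_props(2)] by blast
  moreover have "lit a (val a) \<in> formulas (lang_params L (univ M)) y" if "a \<in> A \<inter> B" for a
    by (rule fm_pow_inst_formulas[OF \<phi>]) (use that A in blast)
  hence "\<pi> \<union> ?\<Sigma> \<subseteq> formulas (lang_params L (univ M)) y"
    using \<pi>(1) by (simp add: image_subset_iff)
  ultimately obtain b where b: "b \<in> tuples M y" "realizes M b (\<pi> \<union> ?\<Sigma>)"
    using consistent_realized[OF sat fin _ _ \<pi>(2), of ?\<Sigma>] B by (meson finite_Int finite_imageI)
  have "holds b a = val a" if "a \<in> A \<inter> B" for a
    using b(2) that by (auto simp: realizes_def ball_Un sat_fm_pow_inst)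
  hence "disagree b \<inter> B = {} \<inter> B" by (auto simp: disagree_def)
  moreover have "disagree b \<in> realized" using b by (auto simp: realized_def realizes_def)
  ultimately show "\<exists>c'\<in>realized. c' \<inter> B = {} \<inter> B" by blast
qed

text \<open>Taking symmetric differences with a fixed set permutes the traces on \<open>B\<close>,
  so it preserves shattering.\<close>

lemma vc_le_C:
  assumes "vc M x y \<phi> \<le> enat d"
  shows "vc_le C d"
proof (rule vc_le_closure_class, unfold vc_le_def, intro allI impI)
  fix B :: "(nat \<Rightarrow> 'u) set" assume B: "finite B" "shatters realized B"
  have BA: "B \<subseteq> A" using shatters_superset[OF B(2)] realized_subset by blast
  let ?F = "(\<lambda>b. {a \<in> tuples M x. holds b a}) ` tuples M y"
  have "shatters ?F B"
    unfolding shatters_def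
  proof (intro allI impI)
    fix D assume D: "D \<subseteq> B"
    have "{a \<in> B. (a \<in> D) \<noteq> val a} \<subseteq> B" by blast
    then obtain S where S: "S \<in> realized" "S \<inter> B = {a \<in> B. (a \<in> D) \<noteq> val a}"
      using B(2) unfolding shatters_def by meson
    then obtain b where b: "b \<in> tuples M y" "S = disagree b" by (auto simp: realized_def)
    have "a \<in> D \<longleftrightarrow> holds b a" if a: "a \<in> B" for a
    proof -
      have "a \<in> disagree b \<longleftrightarrow> (a \<in> D) \<noteq> val a" using S(2) a unfolding b(2) by blast
      moreover have "a \<in> disagree b \<longleftrightarrow> holds b a \<noteq> val a" using a BA by (auto simp: disagree_def)
      ultimately show ?thesis by blast
    qed
    hence "{a \<in> tuples M x. holds b a} \<inter> B = D" using D BA A by auto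
    thus "\<exists>S\<in>?F. S \<inter> B = D" using b(1) by blast
  qed
  thus "card B \<le> d" using vc_dim_leD[OF assms[unfolded vc_def] B(1)] by simp
qed

text \<open>Distinct tuples may yield the same formula, so the truth values are compared at a
  realization that agrees with \<open>c\<close> at both tuples.\<close>

lemma lit_in_type_of:
  assumes c: "c \<in> C" and a: "a \<in> A"
  shows "lit a \<epsilon> \<in> type_of c \<longleftrightarrow> \<epsilon> = ((a \<in> c) \<noteq> val a)"
proof
  assume "lit a \<epsilon> \<in> type_of c"
  then obtain a' where a': "a' \<in> A" "lit a \<epsilon> = lit a' ((a' \<in> c) \<noteq> val a')" by (auto simp: type_of_def)
  obtain b where "\<forall>a\<in>{a, a'}. holds b a = ((a \<in> c) \<noteq> val a)"
    using C_realized[OF c, of "{a, a'}"] a a'(1) by auto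
  moreover have "sat (with_params M) b (lit a \<epsilon>) = sat (with_params M) b (lit a' ((a' \<in> c) \<noteq> val a'))"
    using a'(2) by simp
  ultimately show "\<epsilon> = ((a \<in> c) \<noteq> val a)" by (auto simp: sat_fm_pow_inst)
qed (use a in \<open>auto simp: type_of_def\<close>)

lemma type_of_opp_types:
  assumes c: "c \<in> C"
  shows "type_of c \<in> opp_types M x y \<phi> \<pi> A"
proof -
  have sub: "type_of c \<subseteq> opp_fms x \<phi> A" by (auto simp: type_of_def opp_fms_def)
  have cons: "consistent M y (type_of c \<union> \<pi>)"
    unfolding consistent_def
  proof (intro allI impI)
    fix \<Sigma> assume \<Sigma>: "\<Sigma> \<subseteq> type_of c \<union> \<pi>" "finite \<Sigma>"
    let ?f = "\<lambda>a. lit a ((a \<in> c) \<noteq> val a)"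
    have "\<Sigma> \<inter> type_of c \<subseteq> ?f ` A" by (auto simp: type_of_def)
    then obtain B where B: "B \<subseteq> A" "finite B" "\<Sigma> \<inter> type_of c = ?f ` B"
      using finite_subset_image[of "\<Sigma> \<inter> type_of c" ?f A] \<Sigma>(2) by auto
    obtain b where b: "b \<in> tuples M y" "realizes M b \<pi>" "\<forall>a\<in>B. holds b a = ((a \<in> c) \<noteq> val a)"
      using C_realized[OF c B(2,1)] by blast
    have "realizes M b (?f ` B)" using b(3) by (auto simp: realizes_def sat_fm_pow_inst)
    hence "realizes M b ((\<Sigma> \<inter> type_of c) \<union> \<pi>)" using b(2) unfolding B(3) realizes_def by blast
    hence "realizes M b \<Sigma>" using \<Sigma>(1) unfolding realizes_def by blast
    thus "\<exists>b\<in>tuples M y. realizes M b \<Sigma>" using b(1) by blast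
  qed
  have "p' = type_of c"
    if p': "type_of c \<subseteq> p'" "p' \<subseteq> opp_fms x \<phi> A" "consistent M y p'" for p'
  proof
    show "p' \<subseteq> type_of c"
    proof
      fix \<psi> assume "\<psi> \<in> p'"
      then obtain a \<epsilon> where a: "a \<in> A" "\<psi> = lit a \<epsilon>" using p'(2) by (auto simp: opp_fms_def)
      have "lit a ((a \<in> c) \<noteq> val a) \<in> type_of c" using a(1) by (auto simp: type_of_def)
      moreover have "\<epsilon> = ((a \<in> c) \<noteq> val a)"
        by (rule not_both[OF p'(3), of a]) (use \<open>\<psi> \<in> p'\<close> a calculation p'(1) in auto)
      ultimately show "\<psi> \<in> type_of c" using a(2) by simp
    qed
  qed (rule p'(1))
  thus ?thesis using sub cons consistent_mono[OF cons, of "type_of c"]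
    by (auto simp: opp_types_def opp_type_def)
qed

lemma compressible_type_of:
  assumes c: "c \<in> C" and cc: "compr C k c"
  shows "compressible M x y \<phi> \<pi> A k (type_of c)"
  unfolding compressible_def
proof (intro allI impI)
  fix A0 assume A0: "A0 \<subseteq> A" "finite A0"
  obtain A1 where A1: "finite A1" "card A1 \<le> k"
    and imp: "\<forall>c'\<in>C. c' \<inter> A1 = c \<inter> A1 \<longrightarrow> c' \<inter> A0 = c \<inter> A0"
    using cc A0(2) unfolding compr_def by meson
  have agree: "holds b a = ((a \<in> c) \<noteq> val a) \<longleftrightarrow> (a \<in> disagree b \<longleftrightarrow> a \<in> c)" if "a \<in> A" for a b
    using that by (auto simp: disagree_def)
  \<comment> \<open>Points of \<open>A1\<close> outside \<open>A\<close> carry no information, as no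
    member of \<open>C\<close> contains them.\<close>
  have "implies M y (type_restrict x \<phi> (type_of c) (A1 \<inter> A) \<union> \<pi>) (type_restrict x \<phi> (type_of c) A0)"
    unfolding implies_def
  proof (intro ballI impI)
    fix b assume b: "b \<in> tuples M y" "realizes M b (type_restrict x \<phi> (type_of c) (A1 \<inter> A) \<union> \<pi>)"
    have "realizes M b \<pi>" using b(2) by (auto simp: realizes_def)
    hence "disagree b \<in> realized" using b(1) by (auto simp: realized_def)
    hence DC: "disagree b \<in> C" using closure_class_superset by blast
    have "a \<in> disagree b \<longleftrightarrow> a \<in> c" if "a \<in> A1" for a
    proof (cases "a \<in> A")
      case True
      have "lit a ((a \<in> c) \<noteq> val a) \<in> type_restrict x \<phi> (type_of c) (A1 \<inter> A)"
        using True that by (auto simp: type_restrict_def type_of_def opp_fms_def)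
      hence "sat (with_params M) b (lit a ((a \<in> c) \<noteq> val a))"
        using b(2) unfolding realizes_def by blast
      thus ?thesis using agree[OF True] by (simp add: sat_fm_pow_inst)
    next
      case False
      thus ?thesis using C_subset[OF c] C_subset[OF DC] by blast
    qed
    hence "disagree b \<inter> A1 = c \<inter> A1" by blast
    hence eq: "disagree b \<inter> A0 = c \<inter> A0" using imp DC by blast
    show "realizes M b (type_restrict x \<phi> (type_of c) A0)"
      unfolding realizes_def
    proof
      fix \<psi> assume "\<psi> \<in> type_restrict x \<phi> (type_of c) A0"
      then obtain a \<epsilon> where a: "a \<in> A0" "\<psi> = lit a \<epsilon>" "lit a \<epsilon> \<in> type_of c"
        by (auto simp: type_restrict_def opp_fms_def)
      have aA: "a \<in> A" using a(1) A0(1) by blast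
      have "\<epsilon> = ((a \<in> c) \<noteq> val a)" using lit_in_type_of[OF c aA] a(3) by blast
      moreover have "a \<in> disagree b \<longleftrightarrow> a \<in> c" using eq a(1) by blast
      ultimately show "sat (with_params M) b \<psi>"
        using agree[OF aA] a(2) by (simp add: sat_fm_pow_inst)
    qed
  qed
  moreover have "finite (A1 \<inter> A)" "card (A1 \<inter> A) \<le> k"
    using A1 card_mono[OF A1(1), of "A1 \<inter> A"] by auto
  ultimately show "\<exists>A1\<subseteq>A. finite A1 \<and> card A1 \<le> k \<and>
    implies M y (type_restrict x \<phi> (type_of c) A1 \<union> \<pi>) (type_restrict x \<phi> (type_of c) A0)"
    by blast
qed

lemma rounded_average_type_of:
  fixes \<alpha> :: real
  assumes P: "\<And>i. i < n \<Longrightarrow> P i \<in> C" and \<alpha>: "1 / 2 \<le> \<alpha>"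
    and avg: "\<And>a. real (card {i. i < n \<and> a \<notin> P i}) > \<alpha> * real n"
  shows "p = rounded_average x \<phi> A \<alpha> n (\<lambda>i. type_of (P i))"
proof -
  have iff: "real (card {i. i < n \<and> lit a \<epsilon> \<in> type_of (P i)}) > \<alpha> * real n \<longleftrightarrow> lit a \<epsilon> \<in> p"
    if a: "a \<in> A" for a \<epsilon>
  proof -
    have eq: "{i. i < n \<and> lit a \<epsilon> \<in> type_of (P i)} = {i. i < n \<and> (\<epsilon> = val a \<longleftrightarrow> a \<notin> P i)}"
      using lit_in_type_of[OF P a] by auto
    show ?thesis
    proof (cases "\<epsilon> = val a")
      case True
      thus ?thesis using avg[of a] lit_in_p[OF a] unfolding eq by simp
    next
      case False
      have "card ({i. i < n \<and> a \<in> P i} \<union> {i. i < n \<and> a \<notin> P i}) =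
          card {i. i < n \<and> a \<in> P i} + card {i. i < n \<and> a \<notin> P i}"
        by (rule card_Un_disjoint) auto
      moreover have "{i. i < n \<and> a \<in> P i} \<union> {i. i < n \<and> a \<notin> P i} = {..<n}" by auto
      ultimately have "real n = real (card {i. i < n \<and> a \<in> P i}) + real (card {i. i < n \<and> a \<notin> P i})"
        by simp
      \<comment> \<open>With \<alpha> at least one half, a literal and its negation cannot both
        exceed the threshold.\<close>
      moreover have "1 / 2 * real n \<le> \<alpha> * real n" using \<alpha> by (rule mult_right_mono) simp
      ultimately have "\<not> real (card {i. i < n \<and> a \<in> P i}) > \<alpha> * real n"
        using avg[of a] by linarith
      thus ?thesis using False lit_in_p[OF a] unfolding eq by simp
    qed
  qed
  show ?thesis
  proof
    show "p \<subseteq> rounded_average x \<phi> A \<alpha> n (\<lambda>i. type_of (P i))"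
    proof
      fix \<psi> assume "\<psi> \<in> p"
      then obtain a \<epsilon> where "a \<in> A" "\<psi> = lit a \<epsilon>" using p_props(1) by (auto simp: opp_fms_def)
      thus "\<psi> \<in> rounded_average x \<phi> A \<alpha> n (\<lambda>i. type_of (P i))"
        using \<open>\<psi> \<in> p\<close> iff unfolding rounded_average_def by blast
    qed
    show "rounded_average x \<phi> A \<alpha> n (\<lambda>i. type_of (P i)) \<subseteq> p"
      using iff unfolding rounded_average_def by blast
  qed
qed

end

theorem theorem5p17:
  fixes d :: nat and \<alpha> :: real and N_pq :: "nat \<Rightarrow> nat \<Rightarrow> nat"
  assumes "1 / 2 \<le> \<alpha>" and "\<alpha> < 1" and "pq_function N_pq"
  shows "\<exists>n k.
    n = (LEAST m::nat. (1 - \<alpha>) * real m > 2 ^ (d + 1) - 1) \<and>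
    k = k_sd (N_pq n (2 ^ (d + 1))) d \<and>
    (\<forall>(L :: ('f, 'r) language) T (M :: ('f, 'r, 'u) fo_structure) x y \<phi>.
       complete_theory L T \<and> monster_model L T M \<and>
       finite x \<and> finite y \<and> x \<inter> y = {} \<and> \<phi> \<in> formulas L (x \<union> y) \<and> vc M x y \<phi> \<le> enat d \<longrightarrow>
       (\<forall>A \<pi>. A \<subseteq> tuples M x \<and> small M A \<and> partial_type L M (univ M) y \<pi> \<and> small M \<pi> \<longrightarrow>
          (\<forall>p \<in> opp_types M x y \<phi> \<pi> A.
             \<exists>P. (\<forall>i<n. P i \<in> compressible_opp_types M x y \<phi> \<pi> k A) \<and>
                 p = rounded_average x \<phi> A \<alpha> n P)))"
proof (rule exI, rule exI, intro conjI refl allI impI ballI)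
  let ?n = "LEAST m::nat. (1 - \<alpha>) * real m > 2 ^ (d + 1) - 1"
  let ?k = "k_sd (N_pq ?n (2 ^ (d + 1))) d"
  fix L :: "('f, 'r) language" and T and M :: "('f, 'r, 'u) fo_structure" and x y \<phi> A \<pi> p
  assume H: "complete_theory L T \<and> monster_model L T M \<and> finite x \<and> finite y \<and> x \<inter> y = {} \<and>
      \<phi> \<in> formulas L (x \<union> y) \<and> vc M x y \<phi> \<le> enat d"
    "A \<subseteq> tuples M x \<and> small M A \<and> partial_type L M (univ M) y \<pi> \<and> small M \<pi>"
    "p \<in> opp_types M x y \<phi> \<pi> A"
  interpret opp_setting L M x y \<phi> \<pi> A p
    by unfold_locales (use H in \<open>auto simp: monster_model_def partial_type_def\<close>)
  \<comment> \<open>Existence is what makes \<open>LEAST\<close> satisfy its defining inequality; it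
    holds because \<open>1 - \<alpha>\<close> is positive.\<close>
  have "\<exists>m::nat. (1 - \<alpha>) * real m > 2 ^ (d + 1) - 1"
    using reals_Archimedean3[of "1 - \<alpha>"] assms(2) by (auto simp: mult.commute)
  hence n: "(1 - \<alpha>) * real ?n > 2 ^ (d + 1) - 1" by (rule LeastI_ex)
  have "vc M x y \<phi> \<le> enat d" using H(1) by blast
  from rounded_average_sets[OF assms(3,1,2) n refl closed_closure_class vc_le_C[OF this] empty_in_C]
  obtain P where P: "\<forall>i<?n. P i \<in> C \<and> compr C ?k (P i)"
    "\<forall>a. real (card {i. i < ?n \<and> a \<notin> P i}) > \<alpha> * real ?n" by (elim exE conjE)
  have "type_of (P i) \<in> compressible_opp_types M x y \<phi> \<pi> ?k A" if "i < ?n" for i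
    using P(1) that type_of_opp_types compressible_type_of
    unfolding compressible_opp_types_def by blast
  moreover have "p = rounded_average x \<phi> A \<alpha> ?n (\<lambda>i. type_of (P i))"
    using P by (intro rounded_average_type_of assms(1)) auto
  ultimately show "\<exists>P. (\<forall>i<?n. P i \<in> compressible_opp_types M x y \<phi> \<pi> ?k A) \<and>
      p = rounded_average x \<phi> A \<alpha> ?n P"
    by (intro exI[of _ "\<lambda>i. type_of (P i)"]) blast
qed simp_all

end
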